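(* Let $\mathcal M$ be a Hausdorff topological space, $X$ a Banach space, $P:\mathcal M\to L(X)$ a projection-valued mapping, and $\ell:[a,b]\to\mathcal M$ a continuous path in $\mathcal M$. Assume that $A=P\circ\ell$ is right-continuous or left-continuous at each point of $(a,b)$, has a finite $p$-variation for a certain $p\in(0,2)$, $I+\Delta^+A(t)$ is invertible for all $t\in[a,b)$, and $I+\Delta^-A(t)$ is invertible for all $t\in(a,b]$. Then both the Riemann-Stieltjes product integral and the Riemann-Haahti product of $P\circ\ell$ exist, and $$\prod_a^bP(\ell(t))=\prod_a^b(I+\mathrm dP(\ell(t)))\cdot P(\ell(a)).$$
   Context: $L(X)$ is the Banach algebra of bounded linear operators on $X$, with identity $I$. $P$ is projection-valued if $P(x)P(x)=P(x)$ for all $x\in\mathcal M$. The $p$-variation of $A:[a,b]\to L(X)$ is $\sup\left(\sum_{i=1}^m\|A(t_i)-A(t_{i-1})\|^p\right)^{1/p}$ over all partitions $a=t_0<\dots<t_m=b$. A mapping with finite $p$-variation is regulated (has one-sided limits), and $\Delta^+A(t)=A(t+)-A(t)$ for $t\in[a,b)$, $\Delta^-A(t)=A(t)-A(t-)$ for $t\in(a,b]$. A tagged partition $(\xi_i,[t_{i-1},t_i])_{i=1}^m$ of $[a,b]$ has $a=t_0<\dots<t_m=b$, $\xi_i\in[t_{i-1},t_i]$; for a constant $\delta>0$ it is $\delta$-fine if $[t_{i-1},t_i]\subset(\xi_i-\delta,\xi_i+\delta)$ for all $i$. Riemann-Stieltjes product integral: $\prod_a^b(I+\mathrm dA(t))=Q$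 if $Q\in L(X)$ is invertible and for every $\varepsilon>0$ there is a constant $\delta>0$ with $\|(I+A(t_m)-A(t_{m-1}))\cdots(I+A(t_1)-A(t_0))-Q\|<\varepsilon$ for every $\delta$-fine tagged partition. Riemann-Haahti product: $\prod_a^bA(t)=P_A$ if $P_A\in L(X)$ (not necessarily invertible) and for every $\varepsilon>0$ there is a constant $\delta>0$ with $\|P_A-A(t_m)A(t_{m-1})\cdots A(t_0)\|<\varepsilon$ for every $\delta$-fine tagged partition. *)

theory Defs
  imports "HOL-Analysis.Analysis"
begin

text \<open>
  \<open>L(X)\<close> is the type \<^typ>\<open>'x \<Rightarrow>\<^sub>L 'x\<close> with multiplication \<open>(o\<^sub>L)\<close>, identity \<^term>\<open>id_blinfun\<close> and the
  operator norm.
\<close>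

definition blinfun_invertible :: "('x::real_normed_vector \<Rightarrow>\<^sub>L 'x) \<Rightarrow> bool" where
  "blinfun_invertible T \<longleftrightarrow> (\<exists>S. S o\<^sub>L T = id_blinfun \<and> T o\<^sub>L S = id_blinfun)"

definition projection_valued :: "('m \<Rightarrow> ('x::real_normed_vector \<Rightarrow>\<^sub>L 'x)) \<Rightarrow> bool" where
  "projection_valued P \<longleftrightarrow> (\<forall>x. P x o\<^sub>L P x = P x)"

text \<open>Only the values \<open>t 0, \<dots>, t m\<close> of the sequence \<open>t\<close> matter.\<close>

definition is_partition :: "real \<Rightarrow> real \<Rightarrow> nat \<Rightarrow> (nat \<Rightarrow> real) \<Rightarrow> bool" where
  "is_partition a b m t \<longleftrightarrow> t 0 = a \<and> t m = b \<and> (\<forall>i<m. t i < t (Suc i))"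

text \<open>\<open>\<xi> i\<close> is the tag of the interval \<open>[t i, t (i + 1)]\<close>, for \<open>i < m\<close>.\<close>

definition is_tagged_partition ::
  "real \<Rightarrow> real \<Rightarrow> nat \<Rightarrow> (nat \<Rightarrow> real) \<Rightarrow> (nat \<Rightarrow> real) \<Rightarrow> bool" where
  "is_tagged_partition a b m t \<xi> \<longleftrightarrow>
     is_partition a b m t \<and> (\<forall>i<m. \<xi> i \<in> {t i..t (Suc i)})"

definition delta_fine :: "real \<Rightarrow> nat \<Rightarrow> (nat \<Rightarrow> real) \<Rightarrow> (nat \<Rightarrow> real) \<Rightarrow> bool" where
  "delta_fine \<delta> m t \<xi> \<longleftrightarrow> (\<forall>i<m. {t i..t (Suc i)} \<subseteq> {\<xi> i - \<delta><..<\<xi> i + \<delta>})"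

definition p_variation ::
  "real \<Rightarrow> real \<Rightarrow> real \<Rightarrow> (real \<Rightarrow> 'v::real_normed_vector) \<Rightarrow> ennreal" where
  "p_variation p a b A =
     (SUP (m, t) \<in> {(m, t). is_partition a b m t}.
        ennreal ((\<Sum>i<m. norm (A (t (Suc i)) - A (t i)) powr p) powr (1 / p)))"

definition right_jump :: "(real \<Rightarrow> 'v::real_normed_vector) \<Rightarrow> real \<Rightarrow> 'v" where
  "right_jump A t = Lim (at_right t) A - A t"

definition left_jump :: "(real \<Rightarrow> 'v::real_normed_vector) \<Rightarrow> real \<Rightarrow> 'v" where
  "left_jump A t = A t - Lim (at_left t) A"

text \<open>\<open>ordered_prod F n = F (n - 1) \<cdots> F 1 F 0\<close>: later factors stand on the left.\<close>

primrec ordered_prod ::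
  "(nat \<Rightarrow> ('x::real_normed_vector \<Rightarrow>\<^sub>L 'x)) \<Rightarrow> nat \<Rightarrow> ('x \<Rightarrow>\<^sub>L 'x)" where
  "ordered_prod F 0 = id_blinfun"
| "ordered_prod F (Suc n) = F n o\<^sub>L ordered_prod F n"

definition has_RS_product_integral ::
  "(real \<Rightarrow> ('x::real_normed_vector \<Rightarrow>\<^sub>L 'x)) \<Rightarrow> ('x \<Rightarrow>\<^sub>L 'x) \<Rightarrow> real \<Rightarrow> real \<Rightarrow> bool" where
  "has_RS_product_integral A Q a b \<longleftrightarrow>
     blinfun_invertible Q \<and>
     (\<forall>\<epsilon>>0. \<exists>\<delta>>0. \<forall>m t \<xi>. is_tagged_partition a b m t \<xi> \<longrightarrow> delta_fine \<delta> m t \<xi> \<longrightarrow>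
        norm (ordered_prod (\<lambda>i. id_blinfun + A (t (Suc i)) - A (t i)) m - Q) < \<epsilon>)"

definition RS_product_integrable ::
  "(real \<Rightarrow> ('x::real_normed_vector \<Rightarrow>\<^sub>L 'x)) \<Rightarrow> real \<Rightarrow> real \<Rightarrow> bool" where
  "RS_product_integrable A a b \<longleftrightarrow> (\<exists>Q. has_RS_product_integral A Q a b)"

definition RS_product_integral ::
  "(real \<Rightarrow> ('x::real_normed_vector \<Rightarrow>\<^sub>L 'x)) \<Rightarrow> real \<Rightarrow> real \<Rightarrow> ('x \<Rightarrow>\<^sub>L 'x)" where
  "RS_product_integral A a b = (THE Q. has_RS_product_integral A Q a b)"

text \<open>The Haahti product has the \<open>m + 1\<close> factors \<open>A (t m), \<dots>, A (t 0)\<close>.\<close>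

definition has_Haahti_product ::
  "(real \<Rightarrow> ('x::real_normed_vector \<Rightarrow>\<^sub>L 'x)) \<Rightarrow> ('x \<Rightarrow>\<^sub>L 'x) \<Rightarrow> real \<Rightarrow> real \<Rightarrow> bool" where
  "has_Haahti_product A R a b \<longleftrightarrow>
     (\<forall>\<epsilon>>0. \<exists>\<delta>>0. \<forall>m t \<xi>. is_tagged_partition a b m t \<xi> \<longrightarrow> delta_fine \<delta> m t \<xi> \<longrightarrow>
        norm (R - ordered_prod (\<lambda>i. A (t i)) (Suc m)) < \<epsilon>)"

definition Haahti_product_exists ::
  "(real \<Rightarrow> ('x::real_normed_vector \<Rightarrow>\<^sub>L 'x)) \<Rightarrow> real \<Rightarrow> real \<Rightarrow> bool" where
  "Haahti_product_exists A a b \<longleftrightarrow> (\<exists>R. has_Haahti_product A R a b)"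

definition Haahti_product ::
  "(real \<Rightarrow> ('x::real_normed_vector \<Rightarrow>\<^sub>L 'x)) \<Rightarrow> real \<Rightarrow> real \<Rightarrow> ('x \<Rightarrow>\<^sub>L 'x)" where
  "Haahti_product A a b = (THE R. has_Haahti_product A R a b)"

end

theory Submission
  imports Defs
begin

text \<open>
  For idempotents \<open>P\<^sub>i\<close> one has \<open>P\<^sub>i\<^sub>+\<^sub>1 P\<^sub>i = (I + P\<^sub>i\<^sub>+\<^sub>1 - P\<^sub>i) P\<^sub>i\<close>, so the finite Haahti products are
  exactly the finite Riemann--Stieltjes products times \<open>P(\<ell>(a))\<close>, and everything reduces to the
  existence of the Riemann--Stieltjes product integral of \<open>A = P \<circ> \<ell>\<close>.

  Let \<open>F(t)\<close> be the supremum of the sums of \<open>p\<close>-th powers of increments over partitions of \<open>[a, t]\<close>;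
  then \<open>\<parallel>A(t) - A(s)\<parallel>\<close> is at most \<open>(F(t) - F(s))\<close> to the power \<open>1/p\<close>. Deleting a point \<open>v\<close> between
  neighbours \<open>u\<close> and \<open>w\<close> changes the product by the norm of \<open>(A(w) - A(v)) (A(v) - A(u))\<close> up to a
  factor bounded uniformly in the partition. By compactness, one-sided continuity makes one of the
  two increments small as soon as \<open>w - u\<close> is small, even across a jump; the rest is controlled by
  a power of \<open>F(w) - F(u)\<close> with exponent above 1 because \<open>p < 2\<close>. Young's point-removal argument
  then shows that the products are Cauchy as the mesh tends to 0. Over a short interval the limit is
  close to \<open>I + A(t) - A(s)\<close>, hence invertible near each point by the jump conditions, and
  multiplicativity together with bisection gives invertibility on \<open>[a, b]\<close>.
\<close>

subsection \<open>Products along lists and removal of points\<close>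

text \<open>Partitions are lists here because points get inserted and deleted. The earliest point
  contributes to the rightmost factor, and lists with fewer than two points give the
  identity.\<close>

fun list_prod :: "(real \<Rightarrow> ('x::real_normed_vector \<Rightarrow>\<^sub>L 'x)) \<Rightarrow> real list \<Rightarrow> ('x \<Rightarrow>\<^sub>L 'x)" where
  "list_prod A (x # y # zs) = list_prod A (y # zs) o\<^sub>L (id_blinfun + A y - A x)"
| "list_prod A zs = id_blinfun"

lemma blinfun_compose_assoc: "(R o\<^sub>L S) o\<^sub>L T = R o\<^sub>L (S o\<^sub>L T)"
  by (rule blinfun_eqI) simp

lemma blinfun_compose_id [simp]: "id_blinfun o\<^sub>L T = T" "T o\<^sub>L id_blinfun = T"
  by (auto intro: blinfun_eqI)

text \<open>Factors belong to consecutive pairs, so the cut point \<open>v\<close> has to occur in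
  both pieces for no factor to be lost.\<close>

lemma list_prod_append:
  "list_prod A (xs @ v # ys) = list_prod A (v # ys) o\<^sub>L list_prod A (xs @ [v])"
proof (induction xs rule: induct_list012)
  case (3 x y zs)
  then show ?case by (simp add: blinfun_compose_assoc)
qed (simp_all)

text \<open>With \<open>X = A v - A u\<close> and \<open>Y = A w - A v\<close>, the two local
  products differ by (I + Y)(I + X) - (I + X + Y) = YX; the factors on both sides are
  common.\<close>

lemma remove_point:
  "norm (list_prod A (xs @ u # v # w # ys) - list_prod A (xs @ u # w # ys))
     \<le> norm (list_prod A (w # ys)) * (norm (A v - A u) * norm (A w - A v)) * norm (list_prod A (xs @ [u]))"
proof -
  let ?L = "list_prod A (w # ys)" and ?R = "list_prod A (xs @ [u])"
  have "list_prod A (xs @ u # v # w # ys) - list_prod A (xs @ u # w # ys)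
        = ?L o\<^sub>L ((A w - A v) o\<^sub>L (A v - A u)) o\<^sub>L ?R"
    unfolding list_prod_append[of A xs u "v # w # ys"] list_prod_append[of A xs u "w # ys"]
    by (rule blinfun_eqI) (simp add: blinfun.bilinear_simps algebra_simps)
  also have "norm \<dots> \<le> norm ?L * (norm (A w - A v) * norm (A v - A u)) * norm ?R"
    by (intro order_trans[OF norm_blinfun_compose] mult_mono) (auto simp: norm_blinfun_compose)
  finally show ?thesis by (simp add: mult.commute)
qed

text \<open>Pigeonhole: the differences of \<open>F\<close> over two consecutive steps add up to two
  telescoping sums, each at most \<open>F y - F x\<close>, so one of the \<open>length E\<close>
  triples is at most the average.\<close>

lemma small_triple:
  fixes F :: "real \<Rightarrow> real"
  assumes "sorted (x # E @ [y])" "E \<noteq> []"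
    and mono: "\<And>u v. x \<le> u \<Longrightarrow> u \<le> v \<Longrightarrow> v \<le> y \<Longrightarrow> F u \<le> F v"
  obtains xs u v w ys where "x # E @ [y] = xs @ u # v # w # ys"
    "F w - F u \<le> 2 * (F y - F x) / length E"
proof -
  define D where "D = x # E @ [y]"
  define n where "n = length E"
  have len: "length D = n + 2" and n: "n > 0" using assms by (auto simp: D_def n_def)
  have sD: "sorted D" using assms(1) by (simp add: D_def)
  have D0: "D ! 0 = x" and Dn: "D ! Suc n = y"
    by (simp_all add: D_def n_def nth_append)
  have DF: "F (D ! i) \<le> F (D ! j)" if "i \<le> j" "j \<le> Suc n" for i j
  proof (rule mono)
    show "D ! i \<le> D ! j" using sD that len
      by (intro sorted_nth_mono) auto
    show "x \<le> D ! i" using sD that len unfolding D0[symmetric]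
      by (intro sorted_nth_mono) auto
    show "D ! j \<le> y" using sD that len unfolding Dn[symmetric]
      by (intro sorted_nth_mono) auto
  qed
  have "\<exists>i<n. F (D ! Suc (Suc i)) - F (D ! i) \<le> 2 * (F y - F x) / n"
  proof (rule ccontr)
    assume "\<not> ?thesis"
    then have "(\<Sum>i<n. 2 * (F y - F x) / n) < (\<Sum>i<n. F (D ! Suc (Suc i)) - F (D ! i))"
      using n by (intro sum_strict_mono) (auto simp: not_le)
    also have "\<dots> = (\<Sum>i<n. F (D ! Suc (Suc i)) - F (D ! Suc i)) + (\<Sum>i<n. F (D ! Suc i) - F (D ! i))"
      by (simp flip: sum.distrib)
    also have "\<dots> = (F (D ! Suc n) - F (D ! Suc 0)) + (F (D ! n) - F (D ! 0))"
      using sum_lessThan_telescope[of "\<lambda>i. F (D ! Suc i)" n]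
        sum_lessThan_telescope[of "\<lambda>i. F (D ! i)" n] by simp
    also have "\<dots> \<le> 2 * (F y - F x)"
      using DF[of 0 "Suc 0"] DF[of n "Suc n"] D0 Dn by simp
    finally show False using n by simp
  qed
  then obtain i where i: "i < n" "F (D ! Suc (Suc i)) - F (D ! i) \<le> 2 * (F y - F x) / n" by blast
  have "D = take i D @ D ! i # D ! Suc i # D ! Suc (Suc i) # drop (Suc (Suc (Suc i))) D"
    using i(1) len by (simp add: Cons_nth_drop_Suc)
  from that[OF this[unfolded D_def] i(2)[unfolded D_def n_def]] show ?thesis .
qed

text \<open>Since \<open>u\<close> precedes and \<open>w\<close> follows the deleted
  \<open>v\<close>, the endpoints \<open>x\<close> and \<open>y\<close> survive. The cases record
  whether \<open>u\<close> is \<open>x\<close> and whether \<open>w\<close> is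
  \<open>y\<close>.\<close>

lemma removed_point_between:
  assumes "x # E @ [y] = xs @ u # v # w # ys"
  obtains E' where "x # E' @ [y] = xs @ u # w # ys" "length E = Suc (length E')"
proof -
  have "\<exists>E'. x # E' @ [y] = xs @ u # w # ys \<and> length E = Suc (length E')"
  proof (cases xs)
    case Nil
    show ?thesis
    proof (cases ys rule: rev_cases)
      case Nil
      then show ?thesis using \<open>xs = []\<close> assms by (intro exI[of _ "[]"]) (auto simp: Cons_eq_append_conv)
    next
      case (snoc zs z)
      then have "x = u" "E = v # w # zs" "y = z" using Nil assms by simp_all
      then show ?thesis using Nil snoc by (intro exI[of _ "w # zs"]) auto
    qed
  next
    case (Cons x' xs')
    show ?thesis
    proof (cases ys rule: rev_cases)
      case Nil
      then have "E @ [y] = (xs' @ [u, v]) @ [w]" "x' = x" using Cons assms by auto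
      then have "E = xs' @ [u, v]" "y = w" unfolding append1_eq_conv by simp_all
      then show ?thesis using Cons Nil \<open>x' = x\<close> by (intro exI[of _ "xs' @ [u]"]) auto
    next
      case (snoc zs z)
      then have "E @ [y] = (xs' @ u # v # w # zs) @ [z]" "x' = x" using Cons assms by auto
      then have "E = xs' @ u # v # w # zs" "y = z" unfolding append1_eq_conv by simp_all
      then show ?thesis using Cons snoc \<open>x' = x\<close> by (intro exI[of _ "xs' @ u # w # zs"]) auto
    qed
  qed
  then show ?thesis using that by blast
qed

text \<open>Young's argument: a block of \<open>n\<close> intermediate points always contains one whose two
  neighbours are \<open>F\<close>-close; removing the points in this order makes the errors summable.\<close>

lemma remove_block:
  fixes A :: "real \<Rightarrow> ('x::real_normed_vector \<Rightarrow>\<^sub>L 'x)"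
  assumes sorted: "sorted (G @ x # E @ y # H)" and sub: "set (G @ x # E @ y # H) \<subseteq> {s..t}"
    and "length (G @ x # E @ y # H) \<le> N"
    and bound: "\<And>D. sorted D \<Longrightarrow> set D \<subseteq> {s..t} \<Longrightarrow> length D < N \<Longrightarrow> norm (list_prod A D) \<le> K"
    and mono: "\<And>u v. x \<le> u \<Longrightarrow> u \<le> v \<Longrightarrow> v \<le> y \<Longrightarrow> F u \<le> F v"
    and defect: "\<And>u v w. x \<le> u \<Longrightarrow> u \<le> v \<Longrightarrow> v \<le> w \<Longrightarrow> w \<le> y \<Longrightarrow>
        norm (A v - A u) * norm (A w - A v) \<le> M * (F w - F u) powr \<theta>"
    and "0 \<le> M" "0 \<le> \<theta>" "0 \<le> K"
  shows "norm (list_prod A (G @ x # E @ y # H) - list_prod A (G @ x # y # H))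
     \<le> K\<^sup>2 * M * (2 * (F y - F x)) powr \<theta> * (\<Sum>k<length E. real (Suc k) powr - \<theta>)"
  using sorted sub assms(3)
proof (induction "length E" arbitrary: E)
  case 0
  then show ?case by simp
next
  case (Suc n)
  have "sorted (x # E @ [y])" "E \<noteq> []"
    using Suc by (auto simp: sorted_append)
  from small_triple[of x E y F, OF this mono] obtain xs u v w ys where
    E: "x # E @ [y] = xs @ u # v # w # ys" and F: "F w - F u \<le> 2 * (F y - F x) / length E" by blast
  from removed_point_between[OF E] obtain E' where
    E': "x # E' @ [y] = xs @ u # w # ys" "length E = Suc (length E')" by blast
  have eq: "G @ x # E @ y # H = (G @ xs) @ u # v # w # (ys @ H)"
    using arg_cong[OF E, of "\<lambda>D. G @ D @ H"] by simp
  have eq': "G @ x # E' @ y # H = (G @ xs) @ u # w # (ys @ H)"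
    using arg_cong[OF E'(1), of "\<lambda>D. G @ D @ H"] by simp
  have IH: "norm (list_prod A (G @ x # E' @ y # H) - list_prod A (G @ x # y # H))
     \<le> K\<^sup>2 * M * (2 * (F y - F x)) powr \<theta> * (\<Sum>k<length E'. real (Suc k) powr - \<theta>)"
  proof (rule Suc.hyps(1))
    show "n = length E'" using Suc E' by simp
    show "sorted (G @ x # E' @ y # H)" "set (G @ x # E' @ y # H) \<subseteq> {s..t}"
      "length (G @ x # E' @ y # H) \<le> N"
      using Suc.prems unfolding eq eq' by (auto simp: sorted_append)
  qed
  \<comment> \<open>Both outer pieces lack \<open>v\<close> and are strictly shorter than the whole
    list. Asking for the bound \<open>K\<close> only below length \<open>N\<close> lets it serve
    later as an induction hypothesis on the length.\<close>
  have L: "norm (list_prod A (w # ys @ H)) \<le> K"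
    using Suc.prems unfolding eq by (intro bound) (auto simp: sorted_append)
  have R: "norm (list_prod A ((G @ xs) @ [u])) \<le> K"
    using Suc.prems unfolding eq by (intro bound) (auto simp: sorted_append)
  have srt: "sorted (xs @ u # v # w # ys)" using \<open>sorted (x # E @ [y])\<close> E by simp
  have "set (xs @ u # v # w # ys) \<subseteq> {x..y}"
    using \<open>sorted (x # E @ [y])\<close> unfolding E[symmetric] by (auto simp: sorted_append)
  then have uvw: "x \<le> u" "u \<le> v" "v \<le> w" "w \<le> y" using srt by (auto simp: sorted_append)
  have "norm (A v - A u) * norm (A w - A v) \<le> M * (F w - F u) powr \<theta>"
    using uvw by (rule defect)
  also have "\<dots> \<le> M * (2 * (F y - F x) / length E) powr \<theta>"
    using F mono[of u w] uvw \<open>0 \<le> M\<close> \<open>0 \<le> \<theta>\<close> by (intro mult_left_mono powr_mono2) auto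
  \<comment> \<open>As \<open>length E = Suc (length E')\<close>, this is the last term of the
    claimed sum; the induction hypothesis supplies the others.\<close>
  also have "\<dots> = M * ((2 * (F y - F x)) powr \<theta> * real (Suc (length E')) powr - \<theta>)"
    using mono[of x y] uvw unfolding E'(2)
    by (subst powr_divide) (auto simp: powr_minus divide_inverse)
  finally have d: "norm (A v - A u) * norm (A w - A v)
      \<le> M * ((2 * (F y - F x)) powr \<theta> * real (Suc (length E')) powr - \<theta>)" .
  have "norm (list_prod A (G @ x # E @ y # H) - list_prod A (G @ x # E' @ y # H))
      \<le> norm (list_prod A (w # ys @ H)) * (norm (A v - A u) * norm (A w - A v))
          * norm (list_prod A ((G @ xs) @ [u]))"
    unfolding eq eq' by (rule remove_point)
  also have "\<dots> \<le> K * (M * ((2 * (F y - F x)) powr \<theta> * real (Suc (length E')) powr - \<theta>)) * K"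
    using \<open>0 \<le> K\<close> \<open>0 \<le> M\<close> by (intro mult_mono[OF mult_mono[OF L d] R]) auto
  finally have "norm (list_prod A (G @ x # E @ y # H) - list_prod A (G @ x # E' @ y # H))
      \<le> K\<^sup>2 * M * (2 * (F y - F x)) powr \<theta> * real (Suc (length E')) powr - \<theta>"
    by (simp add: power2_eq_square mult_ac)
  with IH have "norm (list_prod A (G @ x # E @ y # H) - list_prod A (G @ x # y # H))
     \<le> K\<^sup>2 * M * (2 * (F y - F x)) powr \<theta> * real (Suc (length E')) powr - \<theta>
       + K\<^sup>2 * M * (2 * (F y - F x)) powr \<theta> * (\<Sum>k<length E'. real (Suc k) powr - \<theta>)"
    using norm_triangle_ineq[of "list_prod A (G @ x # E @ y # H) - list_prod A (G @ x # E' @ y # H)"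
      "list_prod A (G @ x # E' @ y # H) - list_prod A (G @ x # y # H)"] by simp
  then show ?case unfolding E'(2) by (simp add: algebra_simps)
qed

subsection \<open>Uniform bounds for products\<close>

lemma summable_Suc_powr: "1 < \<theta> \<Longrightarrow> summable (\<lambda>k. real (Suc k) powr - \<theta>)"
  by (subst summable_Suc_iff) (simp add: summable_real_powr_iff)

lemma sum_Suc_powr_le:
  "1 < \<theta> \<Longrightarrow> (\<Sum>k<n. real (Suc k) powr - \<theta>) \<le> (\<Sum>k. real (Suc k) powr - \<theta>)"
  by (intro sum_le_suminf summable_Suc_powr) auto

text \<open>\<open>control\<close> replaces the variation by increments of one monotone function.
  \<open>small_side\<close> is one-sided continuity made uniform: of two adjacent short increments,
  at most one can contain a large jump.\<close>

locale controlled_path =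
  fixes A :: "real \<Rightarrow> ('x::banach \<Rightarrow>\<^sub>L 'x)" and F :: "real \<Rightarrow> real" and a b p :: real
  assumes p: "0 < p" "p < 2"
    and control: "a \<le> s \<Longrightarrow> s \<le> t \<Longrightarrow> t \<le> b \<Longrightarrow> norm (A t - A s) powr p \<le> F t - F s"
    and small_side: "0 < \<eta> \<Longrightarrow> \<exists>\<delta>>0. \<forall>s u t. a \<le> s \<and> s \<le> u \<and> u \<le> t \<and> t \<le> b \<and> t - s < \<delta> \<longrightarrow>
        norm (A u - A s) \<le> \<eta> \<or> norm (A t - A u) \<le> \<eta>"
begin

lemma F_mono: "a \<le> s \<Longrightarrow> s \<le> t \<Longrightarrow> t \<le> b \<Longrightarrow> F s \<le> F t"
  using control[of s t] by (smt (verit) powr_ge_zero)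

lemma norm_increment_le:
  assumes "a \<le> s" "s \<le> t" "t \<le> b"
  shows "norm (A t - A s) \<le> (F t - F s) powr (1 / p)"
proof -
  have "(norm (A t - A s) powr p) powr (1 / p) \<le> (F t - F s) powr (1 / p)"
    using control[OF assms] p by (intro powr_mono2) auto
  then show ?thesis using p by (simp add: powr_powr)
qed

lemma norm_increment_le':
  assumes "a \<le> x" "x \<le> u" "u \<le> v" "v \<le> y" "y \<le> b"
  shows "norm (A v - A u) \<le> (F y - F x) powr (1 / p)"
proof -
  have "norm (A v - A u) \<le> (F v - F u) powr (1 / p)"
    using assms by (intro norm_increment_le) auto
  also have "\<dots> \<le> (F y - F x) powr (1 / p)"
    using assms F_mono[of u v] F_mono[of x u] F_mono[of v y] p by (intro powr_mono2) auto
  finally show ?thesis .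
qed

text \<open>Strong induction on the length: the bound 2 for shorter lists serves as \<open>K\<close>
  in \<open>remove_block\<close>, with exponent \<open>2 / p\<close>. Deleting all interior points
  leaves I + A(y) - A(x), and a small \<open>\<kappa>\<close> makes both its increment and the
  deletion error small.\<close>

lemma locally_bounded_products:
  obtains \<kappa> where "\<kappa> > 0"
    "\<And>D. sorted D \<Longrightarrow> set D \<subseteq> {a..b} \<Longrightarrow> D \<noteq> [] \<Longrightarrow> F (last D) - F (hd D) \<le> \<kappa> \<Longrightarrow>
       norm (list_prod A D) \<le> 2"
proof -
  define \<theta> where "\<theta> = 2 / p"
  have \<theta>: "1 < \<theta>" using p by (simp add: \<theta>_def field_simps)
  define Z where "Z = (\<Sum>k. real (Suc k) powr - \<theta>)"
  have "((\<lambda>\<kappa>::real. (2 * \<kappa>) powr \<theta>) \<longlongrightarrow> 0) (at_right 0)"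
    by (rule tendsto_zero_powrI[where b = \<theta>])
       (use \<theta> in \<open>auto intro!: tendsto_eq_intros eventually_at_rightI[of 0 1]\<close>)
  moreover have "((\<lambda>\<kappa>::real. \<kappa> powr (1 / p)) \<longlongrightarrow> 0) (at_right 0)"
    by (rule tendsto_zero_powrI[where b = "1 / p"])
       (use p in \<open>auto intro!: eventually_at_rightI[of 0 1]\<close>)
  \<comment> \<open>The 4 is the square of the bound 2. The deletion error and the increment must
    together stay below 1, because the identity already contributes up to 1.\<close>
  ultimately have "((\<lambda>\<kappa>::real. 4 * (2 * \<kappa>) powr \<theta> * Z + \<kappa> powr (1 / p)) \<longlongrightarrow> 4 * 0 * Z + 0) (at_right 0)"
    by (intro tendsto_intros)
  then have "eventually (\<lambda>\<kappa>::real. 4 * (2 * \<kappa>) powr \<theta> * Z + \<kappa> powr (1 / p) < 1) (at_right 0)"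
    by (rule order_tendstoD) simp
  then obtain d where d: "d > 0" "\<And>\<kappa>. 0 < \<kappa> \<Longrightarrow> \<kappa> < d \<Longrightarrow> 4 * (2 * \<kappa>) powr \<theta> * Z + \<kappa> powr (1 / p) < 1"
    by (auto simp: eventually_at_right_field)
  define \<kappa> where "\<kappa> = d / 2"
  have \<kappa>: "\<kappa> > 0" "4 * (2 * \<kappa>) powr \<theta> * Z + \<kappa> powr (1 / p) < 1"
    using d(1) d(2)[of \<kappa>] by (simp_all add: \<kappa>_def)
  have Z: "Z \<ge> 0" unfolding Z_def using \<theta> by (intro suminf_nonneg summable_Suc_powr) auto
  have "norm (list_prod A D) \<le> 2"
    if "sorted D" "set D \<subseteq> {a..b}" "D \<noteq> []" "F (last D) - F (hd D) \<le> \<kappa>" for D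
    using that
  proof (induction "length D" arbitrary: D rule: less_induct)
    case less
    consider x where "D = [x]" | x E y where "D = x # E @ [y]"
      using \<open>D \<noteq> []\<close> by (metis list.exhaust rev_exhaust)
    then show ?case
    proof cases
      case 1
      have "norm (id_blinfun :: 'x \<Rightarrow>\<^sub>L 'x) \<le> 2" by (rule order_trans[OF norm_blinfun_id_le]) simp
      then show ?thesis using 1 by simp
    next
      case 2
      have xy: "a \<le> x" "x \<le> y" "y \<le> b" using less.prems 2 by (auto simp: sorted_append)
      have w: "0 \<le> F y - F x" "F y - F x \<le> \<kappa>" using less.prems 2 F_mono[of x y] xy by auto
      have "norm (list_prod A ([] @ x # E @ y # []) - list_prod A ([] @ x # y # []))
        \<le> 2\<^sup>2 * 1 * (2 * (F y - F x)) powr \<theta> * (\<Sum>k<length E. real (Suc k) powr - \<theta>)"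
      \<comment> \<open>The window \<open>{x..y}\<close> ensures that \<open>F\<close> varies by at
        most \<open>\<kappa>\<close> along every shorter list, as the induction hypothesis
        demands.\<close>
      proof (rule remove_block[where s = x and t = y and N = "length D"])
        show "sorted ([] @ x # E @ [y])" "set ([] @ x # E @ [y]) \<subseteq> {x..y}"
          using less.prems 2 by (auto simp: sorted_append)
      next
        fix D' assume D': "sorted D'" "set D' \<subseteq> {x..y}" "length D' < length D"
        show "norm (list_prod A D') \<le> 2"
        proof (cases "D' = []")
          case True
          have "norm (id_blinfun :: 'x \<Rightarrow>\<^sub>L 'x) \<le> 2" by (rule order_trans[OF norm_blinfun_id_le]) simp
          then show ?thesis using True by simp
        next
          case False
          then have "hd D' \<in> {x..y}" "last D' \<in> {x..y}" using D' by (meson hd_in_set last_in_set subsetD)+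
          then have "F (last D') - F (hd D') \<le> \<kappa>"
            using w xy F_mono[of x "hd D'"] F_mono[of "last D'" y] by auto
          then show ?thesis using less.hyps[of D'] D' False xy by fastforce
        qed
      next
        fix u v w assume uvw: "x \<le> u" "u \<le> v" "v \<le> w" "w \<le> y"
        have "norm (A v - A u) * norm (A w - A v) \<le> (F w - F u) powr (1/p) * (F w - F u) powr (1/p)"
          using uvw xy by (intro mult_mono norm_increment_le') auto
        then show "norm (A v - A u) * norm (A w - A v) \<le> 1 * (F w - F u) powr \<theta>"
          by (simp add: \<theta>_def flip: powr_add)
      qed (use \<theta> 2 xy F_mono in auto)
      also have "\<dots> \<le> 4 * (2 * \<kappa>) powr \<theta> * Z"
        using w \<theta> sum_Suc_powr_le[OF \<theta>, of "length E"] unfolding Z_def[symmetric]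
        by (intro mult_mono powr_mono2 mult_nonneg_nonneg sum_nonneg) auto
      finally have e: "norm (list_prod A D - (id_blinfun + A y - A x)) \<le> 4 * (2 * \<kappa>) powr \<theta> * Z"
        using 2 by simp
      have "norm (A y - A x) \<le> \<kappa> powr (1 / p)"
        using norm_increment_le[OF xy] w p by (smt (verit) powr_mono2 zero_le_divide_iff)
      moreover have "norm (list_prod A D) \<le> norm (list_prod A D - (id_blinfun + A y - A x))
           + (norm (id_blinfun :: 'x \<Rightarrow>\<^sub>L 'x) + norm (A y - A x))"
        using norm_triangle_ineq[of "list_prod A D - (id_blinfun + A y - A x)" "id_blinfun + A y - A x"]
          norm_triangle_ineq[of "id_blinfun :: 'x \<Rightarrow>\<^sub>L 'x" "A y - A x"]
        by (simp add: algebra_simps)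
      ultimately show ?thesis using e \<kappa>(2) norm_blinfun_id_le[where 'a='x] by linarith
    qed
  qed
  with \<kappa>(1) show ?thesis using that by blast
qed

text \<open>The list is cut whenever \<open>F\<close> has grown by more than
  \<open>\<kappa>\<close>. Each piece is bounded by 2, and
  \<open>(F (last D) - F (hd D)) / \<kappa>\<close> bounds the number of cuts.\<close>

lemma bounded_products:
  obtains K where "K \<ge> 0"
    "\<And>D. sorted D \<Longrightarrow> set D \<subseteq> {a..b} \<Longrightarrow> norm (list_prod A D) \<le> K"
proof -
  obtain \<kappa> where \<kappa>: "\<kappa> > 0" and loc:
    "\<And>D. sorted D \<Longrightarrow> set D \<subseteq> {a..b} \<Longrightarrow> D \<noteq> [] \<Longrightarrow> F (last D) - F (hd D) \<le> \<kappa> \<Longrightarrow>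
       norm (list_prod A D) \<le> 2" using locally_bounded_products by blast
  \<comment> \<open>The cost of one cut: the bound 2 for the piece before it, times a bound for the
    factor bridging the cut.\<close>
  define C where "C = 2 * (1 + (F b - F a) powr (1 / p))"
  have C: "C \<ge> 2" by (simp add: C_def)
  have key: "norm (list_prod A D) \<le> 2 * C powr ((F (last D) - F (hd D)) / \<kappa>)"
    if "sorted D" "set D \<subseteq> {a..b}" "D \<noteq> []" for D
    using that
  proof (induction "length D" arbitrary: D rule: less_induct)
    case less
    have "hd D \<in> set D" "last D \<in> set D" using less.prems by simp_all
    moreover have "hd D \<le> z" if "z \<in> set D" for z
      using less.prems(1) that by (cases D) auto
    ultimately have hl: "a \<le> hd D" "hd D \<le> last D" "last D \<le> b"
      using less.prems(2) by auto
    show ?case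
    proof (cases "F (last D) - F (hd D) \<le> \<kappa>")
      case True
      have "norm (list_prod A D) \<le> 2 * 1" using loc less.prems True by simp
      also have "1 \<le> C powr ((F (last D) - F (hd D)) / \<kappa>)"
        using F_mono[OF hl] C \<kappa> by (intro ge_one_powr_ge_zero) auto
      finally show ?thesis by simp
    next
      case False
      \<comment> \<open>The first piece is the longest prefix satisfying \<open>?P\<close>. The
        remainder starts at a point where \<open>F\<close> exceeds its initial value by more than
        \<open>\<kappa>\<close>, so its exponent is smaller by at least 1.\<close>
      let ?P = "\<lambda>z. F z - F (hd D) \<le> \<kappa>"
      have "dropWhile ?P D \<noteq> []" "takeWhile ?P D \<noteq> []"
        using False less.prems \<kappa> last_in_set[of D] by (auto simp: dropWhile_eq_Nil_conv takeWhile_eq_Nil_iff)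
      then obtain v V U u where V: "dropWhile ?P D = v # V" and U: "takeWhile ?P D = U @ [u]"
        by (metis list.exhaust rev_exhaust)
      have v: "F v - F (hd D) > \<kappa>" using hd_dropWhile[of ?P D] V by simp
      have u: "F u - F (hd D) \<le> \<kappa>" using set_takeWhileD[of u ?P D] U by simp
      have D: "D = U @ u # v # V" using takeWhile_dropWhile_id[of ?P D] U V by simp
      have hdD: "hd (U @ [u]) = hd D" by (simp add: D hd_append)
      have "norm (list_prod A (v # V)) \<le> 2 * C powr ((F (last (v # V)) - F (hd (v # V))) / \<kappa>)"
        using less.prems unfolding D by (intro less.hyps) (auto simp: D sorted_append)
      also have "\<dots> \<le> 2 * C powr ((F (last D) - F (hd D)) / \<kappa> - 1)"
      proof (intro mult_left_mono powr_mono)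
        have "last (v # V) = last D" by (simp add: D)
        then show "(F (last (v # V)) - F (hd (v # V))) / \<kappa> \<le> (F (last D) - F (hd D)) / \<kappa> - 1"
          using v \<kappa> divide_right_mono[of "F (last D) - F v" "F (last D) - F (hd D) - \<kappa>" \<kappa>]
          by (simp add: diff_divide_distrib)
      qed (use C in auto)
      finally have nV: "norm (list_prod A (v # V)) \<le> 2 * C powr ((F (last D) - F (hd D)) / \<kappa> - 1)" .
      have nU: "norm (list_prod A (U @ [u])) \<le> 2"
        using less.prems u hdD by (intro loc) (auto simp: D sorted_append)
      have "norm (A v - A u) \<le> (F b - F a) powr (1 / p)"
        using less.prems by (intro norm_increment_le') (auto simp: D sorted_append)
      then have nm: "norm (id_blinfun + A v - A u) \<le> 1 + (F b - F a) powr (1 / p)"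
        using norm_triangle_ineq[of "id_blinfun :: 'x \<Rightarrow>\<^sub>L 'x" "A v - A u"]
          norm_blinfun_id_le[where 'a='x] by (simp add: algebra_simps)
      have "list_prod A D = list_prod A (v # V) o\<^sub>L (id_blinfun + A v - A u) o\<^sub>L list_prod A (U @ [u])"
        unfolding D list_prod_append[of A U u "v # V"] by simp
      also have "norm \<dots> \<le> norm (list_prod A (v # V)) * norm (id_blinfun + A v - A u) * norm (list_prod A (U @ [u]))"
        by (intro order_trans[OF norm_blinfun_compose] mult_mono) (auto simp: norm_blinfun_compose)
      also have "\<dots> \<le> 2 * C powr ((F (last D) - F (hd D)) / \<kappa> - 1) * (1 + (F b - F a) powr (1 / p)) * 2"
        by (intro mult_mono[OF mult_mono[OF nV nm] nU]) auto
      also have "\<dots> = 2 * (C powr ((F (last D) - F (hd D)) / \<kappa> - 1) * C powr 1)"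
        using C by (simp add: C_def)
      also have "\<dots> = 2 * C powr ((F (last D) - F (hd D)) / \<kappa>)"
        using C by (simp only: powr_add[symmetric]) simp
      finally show ?thesis .
    qed
  qed
  show ?thesis
  \<comment> \<open>The 1 covers the empty list, which has no endpoints to compare.\<close>
  proof (rule that[of "max 1 (2 * C powr ((F b - F a) / \<kappa>))"])
    fix D assume D: "sorted D" "set D \<subseteq> {a..b}"
    show "norm (list_prod A D) \<le> max 1 (2 * C powr ((F b - F a) / \<kappa>))"
    proof (cases "D = []")
      case True
      then show ?thesis by (simp add: norm_blinfun_id_le le_max_iff_disj)
    next
      case False
      then have "hd D \<in> {a..b}" "last D \<in> {a..b}" using D by (meson hd_in_set last_in_set subsetD)+
      then have "F (last D) - F (hd D) \<le> F b - F a"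
        using F_mono[of a "hd D"] F_mono[of "last D" b] by auto
      then have "2 * C powr ((F (last D) - F (hd D)) / \<kappa>) \<le> 2 * C powr ((F b - F a) / \<kappa>)"
        using C \<kappa> by (intro mult_left_mono powr_mono divide_right_mono) auto
      then show ?thesis using key[OF D False] by simp
    qed
  qed simp
qed

end

subsection \<open>Cauchy property under refinement\<close>

text \<open>The intervals of \<open>D\<close> are filled with points of \<open>E\<close> one at a
  time, from left to right; \<open>G\<close> collects the part already refined. The error of each
  block is an increment of \<open>F\<close>, so the total telescopes.\<close>

lemma refine_chain:
  assumes block: "\<And>G x E y H. P x y \<Longrightarrow> sorted (G @ x # E @ y # H) \<Longrightarrow> set (G @ x # E @ y # H) \<subseteq> S \<Longrightarrow>
      norm (list_prod A (G @ x # E @ y # H) - list_prod A (G @ x # y # H)) \<le> c * (F y - F x)"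
    and "D \<noteq> []" "E \<noteq> []" "hd E = hd D" "last E = last D" "set D \<subseteq> set E"
    and "sorted_wrt (<) D" "sorted_wrt (<) E" "sorted (G @ E)" "set (G @ E) \<subseteq> S" "successively P D"
  shows "norm (list_prod A (G @ E) - list_prod A (G @ D)) \<le> c * (F (last D) - F (hd D))"
  using assms(2-)
proof (induction D arbitrary: G E rule: induct_list012)
  case (2 x)
  then obtain E1 where E: "E = x # E1" by (cases E) auto
  have "E1 = []"
  proof (rule ccontr)
    assume "E1 \<noteq> []"
    then have "last E1 \<in> set E1" "last E1 = x" using 2 E by auto
    then show False using \<open>sorted_wrt (<) E\<close> E by auto
  qed
  then show ?case using E by simp
next
  case (3 x y zs)
  then obtain E' where E': "E = x # E'" by (cases E) auto
  have "y \<in> set E'" using 3(7,8) E' by auto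
  then obtain E1 E2 where "E' = E1 @ y # E2" by (meson split_list)
  with E' have E: "E = x # E1 @ y # E2" by simp
  have IH: "norm (list_prod A ((G @ x # E1) @ y # E2) - list_prod A ((G @ x # E1) @ y # zs))
      \<le> c * (F (last (y # zs)) - F (hd (y # zs)))"
  proof (rule "3.IH"(2))
    show "set (y # zs) \<subseteq> set (y # E2)"
    proof
      fix z assume z: "z \<in> set (y # zs)"
      then have "y \<le> z" using 3(8) by auto
      moreover have "z \<in> set E" using z 3(7) by auto
      ultimately show "z \<in> set (y # E2)" using 3(9) unfolding E by (auto simp: sorted_wrt_append)
    qed
  qed (use 3 E in \<open>auto simp: sorted_wrt_append\<close>)
  have zs: "set zs \<subseteq> set E" "sorted_wrt (<) (y # zs)" using 3 by auto
  have "norm (list_prod A (G @ x # E1 @ y # zs) - list_prod A (G @ x # y # zs)) \<le> c * (F y - F x)"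
  proof (rule block)
    show "P x y" using 3 by simp
    show "sorted (G @ x # E1 @ y # zs)"
      using 3(10) 3(8) zs unfolding E
      by (fastforce simp: sorted_append less_imp_le intro: strict_sorted_imp_sorted)
    show "set (G @ x # E1 @ y # zs) \<subseteq> S"
      using 3(11) zs unfolding E by auto
  qed
  with IH have "norm (list_prod A ((G @ x # E1) @ y # E2) - list_prod A (G @ x # y # zs))
     \<le> c * (F (last (y # zs)) - F (hd (y # zs))) + c * (F y - F x)"
    using norm_triangle_ineq[of "list_prod A ((G @ x # E1) @ y # E2) - list_prod A ((G @ x # E1) @ y # zs)"
      "list_prod A (G @ x # E1 @ y # zs) - list_prod A (G @ x # y # zs)"] by simp
  then show ?case by (simp add: E algebra_simps)
qed simp

text \<open>Tags are replaced by a mesh bound. The case \<open>s = t\<close> is allowed, with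
  \<open>[s]\<close> as the only list, because bisection also meets degenerate intervals.\<close>

definition fine_list :: "real \<Rightarrow> real \<Rightarrow> real \<Rightarrow> real list \<Rightarrow> bool" where
  "fine_list \<delta> s t D \<longleftrightarrow> D \<noteq> [] \<and> hd D = s \<and> last D = t \<and> sorted_wrt (<) D \<and>
     successively (\<lambda>x y. y - x < \<delta>) D"

lemma fine_list_mono: "fine_list \<delta> s t D \<Longrightarrow> \<delta> \<le> \<delta>' \<Longrightarrow> fine_list \<delta>' s t D"
  unfolding fine_list_def by (auto elim!: successively_mono)

lemma fine_list_subset:
  assumes "fine_list \<delta> s t D"
  shows "set D \<subseteq> {s..t}"
proof
  fix z assume z: "z \<in> set D"
  have "s \<le> z" using assms z by (cases D) (auto simp: fine_list_def)
  moreover have "z \<le> t" using assms z by (cases D rule: rev_cases) (auto simp: fine_list_def sorted_wrt_append)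
  ultimately show "z \<in> {s..t}" by simp
qed

text \<open>\<open>tl\<close> drops the second copy of the common endpoint \<open>u\<close>.\<close>

lemma fine_list_join:
  assumes D: "fine_list \<delta> s u D" and D': "fine_list \<delta> u t D'"
  shows "fine_list \<delta> s t (D @ tl D')" "list_prod A (D @ tl D') = list_prod A D' o\<^sub>L list_prod A D"
proof -
  obtain xs where xs: "D = xs @ [u]" using D by (cases D rule: rev_cases) (auto simp: fine_list_def)
  obtain ys where ys: "D' = u # ys" using D' by (cases D') (auto simp: fine_list_def)
  show "fine_list \<delta> s t (D @ tl D')"
    using D D' fine_list_subset[OF D] fine_list_subset[OF D'] unfolding xs ys
    by (fastforce simp: fine_list_def sorted_wrt_append successively_append_iff successively_Cons hd_append)
  show "list_prod A (D @ tl D') = list_prod A D' o\<^sub>L list_prod A D"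
    using list_prod_append[of A xs u ys] by (simp add: xs ys)
qed

lemma fine_list_short: "s \<le> t \<Longrightarrow> t - s < \<delta> \<Longrightarrow> fine_list \<delta> s t (if s = t then [s] else [s, t])"
  by (auto simp: fine_list_def)

text \<open>Bisection: fine lists can be joined, and an interval shorter than
  \<open>\<delta>\<close> is covered by its endpoints alone.\<close>

lemma fine_list_exists:
  assumes "0 < \<delta>" "s \<le> t"
  shows "\<exists>D. fine_list \<delta> s t D"
  using assms(2)
proof (induction rule: Bolzano)
  case (trans s u t)
  then show ?case using fine_list_join by blast
next
  case (local x)
  show ?case
    using \<open>0 < \<delta>\<close> fine_list_short by (intro exI[of _ \<delta>]) (meson order_trans)
qed

lemma common_refinement:
  assumes D: "fine_list \<delta> s t D" and D': "fine_list \<delta>' s t D'"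
  obtains E where "E \<noteq> []" "hd E = s" "last E = t" "sorted_wrt (<) E" "set E = set D \<union> set D'"
proof -
  define E where "E = sorted_list_of_set (set D \<union> set D')"
  have E: "set E = set D \<union> set D'" "sorted_wrt (<) E" by (simp_all add: E_def)
  have sub: "set E \<subseteq> {s..t}" using fine_list_subset[OF D] fine_list_subset[OF D'] E by simp
  have "D \<noteq> []" "hd D = s" "last D = t" using D by (simp_all add: fine_list_def)
  then have "s \<in> set E" "t \<in> set E" unfolding E(1) by (metis UnI1 hd_in_set, metis UnI1 last_in_set)
  then obtain x E' where "E = x # E'" and "E \<noteq> []" by (cases E) auto
  then have "hd E \<le> s" using \<open>s \<in> set E\<close> E(2) by auto
  moreover have "s \<le> hd E" "last E \<le> t"
    using subsetD[OF sub hd_in_set[OF \<open>E \<noteq> []\<close>]] subsetD[OF sub last_in_set[OF \<open>E \<noteq> []\<close>]] by auto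
  moreover have "t \<le> last E"
    using \<open>t \<in> set E\<close> E(2) by (cases E rule: rev_cases) (auto simp: sorted_wrt_append)
  ultimately show ?thesis using that[of E] E \<open>E \<noteq> []\<close> by auto
qed

text \<open>Only the power \<open>1 - p/2\<close> of the small factor is spent on smallness: what remains is a power
  of \<open>r\<close> whose exponent still exceeds 1.\<close>

lemma product_with_small_factor:
  fixes x y r :: real
  assumes "0 < p" "p < 2" "0 \<le> x" "0 \<le> y" "x \<le> r powr (1 / p)" "y \<le> r powr (1 / p)" "x \<le> \<eta>"
  shows "x * y \<le> \<eta> powr (1 - p / 2) * r powr (1 / p + 1 / 2)"
proof -
  have "x * y = x powr (1 - p / 2) * x powr (p / 2) * y"
    using assms by (simp flip: powr_add)
  also have "\<dots> \<le> \<eta> powr (1 - p / 2) * (r powr (1 / p)) powr (p / 2) * r powr (1 / p)"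
    using assms by (intro mult_mono powr_mono2 mult_nonneg_nonneg) auto
  also have "\<dots> = \<eta> powr (1 - p / 2) * r powr (1 / p + 1 / 2)"
    using assms by (simp add: powr_powr mult.assoc add.commute flip: powr_add)
  finally show ?thesis .
qed

section \<open>Cauchy estimate for products over fine partitions\<close>

context controlled_path
begin

text \<open>One factor of the defects is at most \<open>\<eta>\<close>, so
  \<open>remove_block\<close> applies with \<open>M = \<eta> powr (1 - p / 2)\<close> and an
  exponent above 1. One power of \<open>F y - F x\<close> is kept, so that errors add up along a
  partition; the remaining power is bounded by that of \<open>F b - F a\<close>, and
  \<open>\<eta>\<close> makes the constant small.\<close>

lemma block_error:
  assumes "0 < c"
  obtains \<delta> where "\<delta> > 0"
    "\<And>G x E y H. y - x < \<delta> \<Longrightarrow> sorted (G @ x # E @ y # H) \<Longrightarrow> set (G @ x # E @ y # H) \<subseteq> {a..b} \<Longrightarrow>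
      norm (list_prod A (G @ x # E @ y # H) - list_prod A (G @ x # y # H)) \<le> c * (F y - F x)"
proof -
  obtain K where K: "K \<ge> 0" and bound: "\<And>D. sorted D \<Longrightarrow> set D \<subseteq> {a..b} \<Longrightarrow> norm (list_prod A D) \<le> K"
    using bounded_products by blast
  define \<theta> where "\<theta> = 1 / p + 1 / 2"
  have \<theta>: "1 < \<theta>" using p by (simp add: \<theta>_def field_simps)
  define Z where "Z = (\<Sum>k. real (Suc k) powr - \<theta>)"
  have Z: "Z \<ge> 0" unfolding Z_def using \<theta> by (intro suminf_nonneg summable_Suc_powr) auto
  \<comment> \<open>\<open>B\<close> gathers every constant other than the power of
    \<open>\<eta>\<close>. Then \<open>\<eta>\<close> is chosen so that its power is
    \<open>c / (B + 1)\<close>, where the 1 keeps the denominator positive.\<close>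
  define B where "B = K\<^sup>2 * 2 powr \<theta> * (F b - F a) powr (\<theta> - 1) * Z"
  have B: "B \<ge> 0" using Z by (simp add: B_def)
  define \<eta> where "\<eta> = (c / (B + 1)) powr (1 / (1 - p / 2))"
  have \<eta>: "\<eta> > 0" using assms B by (simp add: \<eta>_def)
  have "B * \<eta> powr (1 - p / 2) = B * (c / (B + 1))"
    using p assms B by (simp add: \<eta>_def powr_powr)
  also have "\<dots> \<le> c" using B assms by (simp add: field_simps)
  finally have c: "B * \<eta> powr (1 - p / 2) \<le> c" .
  obtain \<delta> where \<delta>: "\<delta> > 0" and small: "\<And>s u t. a \<le> s \<Longrightarrow> s \<le> u \<Longrightarrow> u \<le> t \<Longrightarrow> t \<le> b \<Longrightarrow> t - s < \<delta> \<Longrightarrow>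
        norm (A u - A s) \<le> \<eta> \<or> norm (A t - A u) \<le> \<eta>"
    using small_side[OF \<eta>] by blast
  show ?thesis
  proof (rule that[OF \<delta>])
    fix G x E y H
    assume xy: "y - x < \<delta>" and srt: "sorted (G @ x # E @ y # H)" and sub: "set (G @ x # E @ y # H) \<subseteq> {a..b}"
    have ord: "a \<le> x" "x \<le> y" "y \<le> b" using srt sub by (auto simp: sorted_append)
    have w: "0 \<le> F y - F x" "F y - F x \<le> F b - F a"
      using F_mono[of x y] F_mono[of a x] F_mono[of y b] ord by auto
    have "norm (list_prod A (G @ x # E @ y # H) - list_prod A (G @ x # y # H))
      \<le> K\<^sup>2 * \<eta> powr (1 - p / 2) * (2 * (F y - F x)) powr \<theta> * (\<Sum>k<length E. real (Suc k) powr - \<theta>)"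
    proof (rule remove_block[OF srt sub order_refl bound])
      fix u v w assume uvw: "x \<le> u" "u \<le> v" "v \<le> w" "w \<le> y"
      have n: "norm (A v - A u) \<le> (F w - F u) powr (1 / p)" "norm (A w - A v) \<le> (F w - F u) powr (1 / p)"
        using uvw ord by (auto intro!: norm_increment_le')
      have "norm (A v - A u) \<le> \<eta> \<or> norm (A w - A v) \<le> \<eta>"
        using uvw ord xy by (intro small) auto
      then show "norm (A v - A u) * norm (A w - A v) \<le> \<eta> powr (1 - p / 2) * (F w - F u) powr \<theta>"
      proof
        assume "norm (A v - A u) \<le> \<eta>"
        then show ?thesis unfolding \<theta>_def using n p by (intro product_with_small_factor) auto
      next
        assume "norm (A w - A v) \<le> \<eta>"
        then show ?thesis unfolding \<theta>_def using n p
          by (subst mult.commute, intro product_with_small_factor) auto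
      qed
    qed (use \<theta> K ord F_mono in auto)
    also have "\<dots> \<le> K\<^sup>2 * \<eta> powr (1 - p / 2) * (2 * (F y - F x)) powr \<theta> * Z"
      using sum_Suc_powr_le[OF \<theta>, of "length E"] unfolding Z_def[symmetric]
      by (intro mult_left_mono) auto
    also have "\<dots> = K\<^sup>2 * \<eta> powr (1 - p / 2) * (2 powr \<theta> * ((F y - F x) * (F y - F x) powr (\<theta> - 1))) * Z"
      using w by (simp add: powr_mult[of 2 "F y - F x"] powr_mult_base del: right_diff_distrib_numeral)
    also have "\<dots> \<le> K\<^sup>2 * \<eta> powr (1 - p / 2) * (2 powr \<theta> * ((F y - F x) * (F b - F a) powr (\<theta> - 1))) * Z"
      using w \<theta> Z by (intro mult_left_mono mult_right_mono powr_mono2) auto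
    also have "\<dots> = (B * \<eta> powr (1 - p / 2)) * (F y - F x)" by (simp add: B_def mult_ac)
    also have "\<dots> \<le> c * (F y - F x)" using c w by (intro mult_right_mono) auto
    finally show "norm (list_prod A (G @ x # E @ y # H) - list_prod A (G @ x # y # H)) \<le> c * (F y - F x)" .
  qed
qed

text \<open>Both products are compared with that of the common refinement, at a cost of at most
  \<open>e / 2\<close> each. The same \<open>\<delta>\<close> serves all subintervals.\<close>

lemma list_prod_Cauchy:
  assumes "0 < e"
  obtains \<delta> where "\<delta> > 0"
    "\<And>s t D D'. a \<le> s \<Longrightarrow> t \<le> b \<Longrightarrow> fine_list \<delta> s t D \<Longrightarrow> fine_list \<delta> s t D' \<Longrightarrow>
       norm (list_prod A D - list_prod A D') \<le> e"
proof -
  define W where "W = \<bar>F b - F a\<bar> + 1"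
  have W: "W > 0" "F b - F a \<le> W" by (auto simp: W_def)
  define c where "c = e / (2 * W)"
  have c: "c > 0" and cW: "2 * (c * W) = e" using assms W by (simp_all add: c_def)
  obtain \<delta> where \<delta>: "\<delta> > 0" and block:
    "\<And>G x E y H. y - x < \<delta> \<Longrightarrow> sorted (G @ x # E @ y # H) \<Longrightarrow> set (G @ x # E @ y # H) \<subseteq> {a..b} \<Longrightarrow>
      norm (list_prod A (G @ x # E @ y # H) - list_prod A (G @ x # y # H)) \<le> c * (F y - F x)"
    using block_error[OF c] by metis
  show ?thesis
  proof (rule that[OF \<delta>])
    fix s t D D'
    assume ab: "a \<le> s" "t \<le> b" and D: "fine_list \<delta> s t D" and D': "fine_list \<delta> s t D'"
    obtain E where E: "E \<noteq> []" "hd E = s" "last E = t" "sorted_wrt (<) E" "set E = set D \<union> set D'"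
      using common_refinement[OF D D'] by blast
    have sub: "set E \<subseteq> {a..b}" using fine_list_subset[OF D] fine_list_subset[OF D'] ab E by auto
    have st: "s \<le> t" using D fine_list_subset[OF D] hd_in_set[of D] by (auto simp: fine_list_def)
    have *: "norm (list_prod A E - list_prod A X) \<le> c * W"
      if X: "fine_list \<delta> s t X" "set X \<subseteq> set E" for X
    proof -
      have "norm (list_prod A ([] @ E) - list_prod A ([] @ X)) \<le> c * (F (last X) - F (hd X))"
        using block X E sub
        by (intro refine_chain[where P = "\<lambda>x y. y - x < \<delta>" and S = "{a..b}"])
           (auto simp: fine_list_def intro: strict_sorted_imp_sorted)
      also have "\<dots> \<le> c * W"
        using c W X F_mono[of a s] F_mono[of t b] ab st by (intro mult_left_mono) (auto simp: fine_list_def)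
      finally show ?thesis by simp
    qed
    have "norm (list_prod A D - list_prod A D') \<le> norm (list_prod A E - list_prod A D) + norm (list_prod A E - list_prod A D')"
      using norm_triangle_ineq4[of "list_prod A E - list_prod A D'" "list_prod A E - list_prod A D"] by simp
    also have "\<dots> \<le> e" using *[OF D] *[OF D'] E(5) cW by simp
    finally show "norm (list_prod A D - list_prod A D') \<le> e" .
  qed
qed

end

subsection \<open>The limit and its invertibility\<close>

lemma blinfun_invertible_compose:
  assumes "blinfun_invertible S" "blinfun_invertible T"
  shows "blinfun_invertible (S o\<^sub>L T)"
proof -
  obtain S' T' where "S' o\<^sub>L S = id_blinfun" "S o\<^sub>L S' = id_blinfun" "T' o\<^sub>L T = id_blinfun" "T o\<^sub>L T' = id_blinfun"
    using assms unfolding blinfun_invertible_def by blast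
  then have "(T' o\<^sub>L S') o\<^sub>L (S o\<^sub>L T) = id_blinfun" "(S o\<^sub>L T) o\<^sub>L (T' o\<^sub>L S') = id_blinfun"
    by (metis blinfun_compose_assoc blinfun_compose_id)+
  then show ?thesis unfolding blinfun_invertible_def by blast
qed

text \<open>The equation ST = I says that S is a fixed point of S -> I + S(I - T), a contraction
  with constant \<open>norm (id_blinfun - T)\<close>. The mirrored map gives a right inverse, and
  the two inverses coincide.\<close>

lemma blinfun_invertible_near_id:
  fixes T :: "'x::banach \<Rightarrow>\<^sub>L 'x"
  assumes "norm (id_blinfun - T) < 1"
  shows "blinfun_invertible T"
proof -
  let ?c = "norm (id_blinfun - T)"
  have "\<exists>!S. id_blinfun + (S o\<^sub>L (id_blinfun - T)) = S"
  proof (rule banach_fix_type[OF norm_ge_zero assms], intro allI)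
    fix R S
    have "(id_blinfun + (R o\<^sub>L (id_blinfun - T))) - (id_blinfun + (S o\<^sub>L (id_blinfun - T)))
        = (R - S) o\<^sub>L (id_blinfun - T)"
      by (rule blinfun_eqI) (simp add: blinfun.bilinear_simps)
    then show "dist (id_blinfun + (R o\<^sub>L (id_blinfun - T))) (id_blinfun + (S o\<^sub>L (id_blinfun - T))) \<le> ?c * dist R S"
      using norm_blinfun_compose[of "R - S" "id_blinfun - T"] by (simp add: dist_norm mult.commute)
  qed
  then obtain S where "id_blinfun + (S o\<^sub>L (id_blinfun - T)) = S" by blast
  moreover have "S o\<^sub>L (id_blinfun - T) = S - (S o\<^sub>L T)"
    by (rule blinfun_eqI) (simp add: blinfun.bilinear_simps)
  ultimately have left: "S o\<^sub>L T = id_blinfun" by (simp add: algebra_simps)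
  have "\<exists>!S. id_blinfun + ((id_blinfun - T) o\<^sub>L S) = S"
  proof (rule banach_fix_type[OF norm_ge_zero assms], intro allI)
    fix R S
    have "(id_blinfun + ((id_blinfun - T) o\<^sub>L R)) - (id_blinfun + ((id_blinfun - T) o\<^sub>L S))
        = (id_blinfun - T) o\<^sub>L (R - S)"
      by (rule blinfun_eqI) (simp add: blinfun.bilinear_simps)
    then show "dist (id_blinfun + ((id_blinfun - T) o\<^sub>L R)) (id_blinfun + ((id_blinfun - T) o\<^sub>L S)) \<le> ?c * dist R S"
      using norm_blinfun_compose[of "id_blinfun - T" "R - S"] by (simp add: dist_norm)
  qed
  then obtain S' where "id_blinfun + ((id_blinfun - T) o\<^sub>L S') = S'" by blast
  moreover have "(id_blinfun - T) o\<^sub>L S' = S' - (T o\<^sub>L S')"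
    by (rule blinfun_eqI) (simp add: blinfun.bilinear_simps)
  ultimately have right: "T o\<^sub>L S' = id_blinfun" by (simp add: algebra_simps)
  have "S = S'" using left right by (metis blinfun_compose_assoc blinfun_compose_id)
  then show ?thesis using left right unfolding blinfun_invertible_def by blast
qed

text \<open>If S inverts T, then I - SR = S(T - R) is small for R near T, so SR is invertible, and R
  = T(SR).\<close>

lemma blinfun_invertible_open:
  fixes T :: "'x::banach \<Rightarrow>\<^sub>L 'x"
  assumes "blinfun_invertible T"
  obtains e where "e > 0" "\<And>R. norm (R - T) < e \<Longrightarrow> blinfun_invertible R"
proof -
  obtain S where S: "S o\<^sub>L T = id_blinfun" "T o\<^sub>L S = id_blinfun"
    using assms unfolding blinfun_invertible_def by blast
  show ?thesis
  proof (rule that[of "1 / (norm S + 1)"])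
    show "0 < 1 / (norm S + 1)" by (simp add: add_nonneg_pos)
    fix R assume R: "norm (R - T) < 1 / (norm S + 1)"
    have eq: "id_blinfun - (S o\<^sub>L R) = S o\<^sub>L (T - R)"
      unfolding S(1)[symmetric] by (rule blinfun_eqI) (simp add: blinfun.bilinear_simps)
    have "norm (id_blinfun - (S o\<^sub>L R)) \<le> norm S * norm (R - T)"
      unfolding eq using norm_blinfun_compose[of S "T - R"] by (simp add: norm_minus_commute)
    also have "\<dots> \<le> (norm S + 1) * norm (R - T)" by (intro mult_right_mono) auto
    also have "\<dots> < 1" using R by (simp add: less_divide_eq add_nonneg_pos mult.commute)
    finally have "blinfun_invertible (S o\<^sub>L R)" by (rule blinfun_invertible_near_id)
    moreover have "blinfun_invertible T" by fact
    ultimately have "blinfun_invertible (T o\<^sub>L (S o\<^sub>L R))" by (rule blinfun_invertible_compose[rotated])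
    then show "blinfun_invertible R" using S(2) by (metis blinfun_compose_assoc blinfun_compose_id(1))
  qed
qed

text \<open>The Riemann-Stieltjes limit without tags and without invertibility of \<open>Q\<close>,
  which is proved only once limits over subintervals are available.\<close>

definition list_prod_limit where
  "list_prod_limit A s t Q \<longleftrightarrow>
     (\<forall>e>0. \<exists>\<delta>>0. \<forall>D. fine_list \<delta> s t D \<longrightarrow> norm (list_prod A D - Q) < e)"

lemma eventually_fine_list:
  assumes "\<And>n. fine_list (inverse (real (Suc n))) s t (D n)" "0 < \<delta>"
  shows "\<exists>N. \<forall>n\<ge>N. fine_list \<delta> s t (D n)"
proof -
  obtain N where N: "inverse (real (Suc N)) < \<delta>" using reals_Archimedean[OF assms(2)] by blast
  have "fine_list \<delta> s t (D n)" if "n \<ge> N" for n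
  proof (rule fine_list_mono[OF assms(1)])
    have "inverse (real (Suc n)) \<le> inverse (real (Suc N))" using that by simp
    then show "inverse (real (Suc n)) \<le> \<delta>" using N by linarith
  qed
  then show ?thesis by blast
qed

lemma list_prod_limit_tendsto:
  assumes "list_prod_limit A s t Q" "\<And>n. fine_list (inverse (real (Suc n))) s t (D n)"
  shows "(\<lambda>n. list_prod A (D n)) \<longlonglongrightarrow> Q"
proof (rule metric_LIMSEQ_I)
  fix e :: real assume "e > 0"
  then obtain \<delta> where "\<delta> > 0" "\<And>D. fine_list \<delta> s t D \<Longrightarrow> norm (list_prod A D - Q) < e"
    using assms(1) unfolding list_prod_limit_def by blast
  then show "\<exists>N. \<forall>n\<ge>N. dist (list_prod A (D n)) Q < e"
    using eventually_fine_list[OF assms(2)] unfolding dist_norm by blast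
qed

lemma fine_lists_exist:
  assumes "s \<le> t"
  obtains D where "\<And>n. fine_list (inverse (real (Suc n))) s t (D n)"
proof -
  have "\<forall>n. \<exists>D. fine_list (inverse (real (Suc n))) s t D"
    using assms by (intro allI fine_list_exists) auto
  then show ?thesis using that by metis
qed

text \<open>Joined fine lists for \<open>[s, u]\<close> and \<open>[u, t]\<close> are fine for
  \<open>[s, t]\<close>, and composition is jointly continuous.\<close>

lemma list_prod_limit_join:
  assumes "s \<le> u" "u \<le> t" "list_prod_limit A s u Q1" "list_prod_limit A u t Q2" "list_prod_limit A s t Q"
  shows "Q = Q2 o\<^sub>L Q1"
proof -
  obtain D where D: "\<And>n. fine_list (inverse (real (Suc n))) s u (D n)" using fine_lists_exist assms by blast
  obtain E where E: "\<And>n. fine_list (inverse (real (Suc n))) u t (E n)" using fine_lists_exist assms by blast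
  have "(\<lambda>n. list_prod A (D n @ tl (E n))) \<longlonglongrightarrow> Q"
    by (rule list_prod_limit_tendsto[OF assms(5)]) (rule fine_list_join(1)[OF D E])
  moreover have "list_prod A (D n @ tl (E n)) = list_prod A (E n) o\<^sub>L list_prod A (D n)" for n
    by (rule fine_list_join[OF D E])
  ultimately have "(\<lambda>n. list_prod A (E n) o\<^sub>L list_prod A (D n)) \<longlonglongrightarrow> Q" by simp
  moreover have "(\<lambda>n. list_prod A (E n) o\<^sub>L list_prod A (D n)) \<longlonglongrightarrow> (Q2 o\<^sub>L Q1)"
    using assms D E
    by (intro bounded_bilinear.tendsto[OF bounded_bilinear_blinfun_compose] list_prod_limit_tendsto)
  ultimately show ?thesis by (rule LIMSEQ_unique)
qed

section \<open>Existence and invertibility of the limit\<close>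

context controlled_path
begin

text \<open>Completeness yields a limit along one sequence of partitions with mesh tending to 0; the
  Cauchy estimate carries it over to all fine partitions.\<close>

lemma list_prod_limit_exists:
  assumes "a \<le> s" "s \<le> t" "t \<le> b"
  shows "\<exists>Q. list_prod_limit A s t Q"
proof -
  obtain D where D: "\<And>n. fine_list (inverse (real (Suc n))) s t (D n)" using fine_lists_exist assms by blast
  have ev: "\<exists>N. \<forall>n\<ge>N. \<forall>D'. fine_list \<delta> s t D' \<longrightarrow> norm (list_prod A D' - list_prod A (D n)) \<le> e"
    if \<delta>: "\<delta> > 0" "\<And>D D'. fine_list \<delta> s t D \<Longrightarrow> fine_list \<delta> s t D' \<Longrightarrow>
       norm (list_prod A D - list_prod A D') \<le> e" for e \<delta>
    using eventually_fine_list[OF D \<delta>(1)] \<delta>(2) by blast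
  have "Cauchy (\<lambda>n. list_prod A (D n))"
  proof (rule metric_CauchyI)
    fix e :: real assume "e > 0"
    then obtain \<delta> where \<delta>: "\<delta> > 0" "\<And>D D'. fine_list \<delta> s t D \<Longrightarrow> fine_list \<delta> s t D' \<Longrightarrow>
       norm (list_prod A D - list_prod A D') \<le> e / 4"
      using list_prod_Cauchy[of "e / 4"] assms by (metis zero_less_divide_iff zero_less_numeral)
    obtain X where X: "fine_list \<delta> s t X" using fine_list_exists \<delta> assms by blast
    obtain N where N: "\<And>n. n \<ge> N \<Longrightarrow> norm (list_prod A X - list_prod A (D n)) \<le> e / 4"
      using ev[OF \<delta>] X by metis
    have "dist (list_prod A (D m)) (list_prod A (D n)) < e" if "m \<ge> N" "n \<ge> N" for m n
      using N[OF that(1)] N[OF that(2)] \<open>e > 0\<close>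
        dist_triangle3[of "list_prod A (D m)" "list_prod A (D n)" "list_prod A X"]
      by (simp add: dist_norm)
    then show "\<exists>N. \<forall>m\<ge>N. \<forall>n\<ge>N. dist (list_prod A (D m)) (list_prod A (D n)) < e" by blast
  qed
  then obtain Q where Q: "(\<lambda>n. list_prod A (D n)) \<longlonglongrightarrow> Q"
    by (metis Cauchy_convergent convergentD)
  have "list_prod_limit A s t Q"
    unfolding list_prod_limit_def
  proof (intro allI impI)
    fix e :: real assume "e > 0"
    then obtain \<delta> where \<delta>: "\<delta> > 0" "\<And>D D'. fine_list \<delta> s t D \<Longrightarrow> fine_list \<delta> s t D' \<Longrightarrow>
       norm (list_prod A D - list_prod A D') \<le> e / 2"
      using list_prod_Cauchy[of "e / 2"] assms by (metis half_gt_zero)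
    have "norm (list_prod A D' - Q) \<le> e / 2" if D': "fine_list \<delta> s t D'" for D'
    proof (rule LIMSEQ_le_const2)
      show "(\<lambda>n. norm (list_prod A D' - list_prod A (D n))) \<longlonglongrightarrow> norm (list_prod A D' - Q)"
        by (intro tendsto_intros Q)
      show "\<exists>N. \<forall>n\<ge>N. norm (list_prod A D' - list_prod A (D n)) \<le> e / 2"
        using ev[OF \<delta>] D' by metis
    qed
    then have "\<forall>D. fine_list \<delta> s t D \<longrightarrow> norm (list_prod A D - Q) < e" using \<open>e > 0\<close> by fastforce
    then show "\<exists>\<delta>>0. \<forall>D. fine_list \<delta> s t D \<longrightarrow> norm (list_prod A D - Q) < e" using \<delta>(1) by blast
  qed
  then show ?thesis by blast
qed

text \<open>On an interval shorter than \<open>\<delta>\<close> the endpoints alone form a fine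
  list, whose product is I + A(t) - A(s); the Cauchy estimate compares it with much finer
  lists.\<close>

lemma list_prod_limit_near_increment:
  assumes "0 < e"
  obtains \<delta> where "\<delta> > 0"
    "\<And>s t Q. a \<le> s \<Longrightarrow> s \<le> t \<Longrightarrow> t \<le> b \<Longrightarrow> t - s < \<delta> \<Longrightarrow> list_prod_limit A s t Q \<Longrightarrow>
       norm (Q - (id_blinfun + A t - A s)) < e"
proof -
  obtain \<delta> where \<delta>: "\<delta> > 0"
    "\<And>s t D D'. a \<le> s \<Longrightarrow> t \<le> b \<Longrightarrow> fine_list \<delta> s t D \<Longrightarrow> fine_list \<delta> s t D' \<Longrightarrow>
       norm (list_prod A D - list_prod A D') \<le> e / 2"
    using list_prod_Cauchy[of "e / 2"] assms by (metis half_gt_zero)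
  show ?thesis
  proof (rule that[OF \<delta>(1)])
    fix s t Q assume st: "a \<le> s" "s \<le> t" "t \<le> b" "t - s < \<delta>" and Q: "list_prod_limit A s t Q"
    obtain \<delta>' where \<delta>': "\<delta>' > 0" "\<And>D. fine_list \<delta>' s t D \<Longrightarrow> norm (list_prod A D - Q) < e / 2"
      using Q assms unfolding list_prod_limit_def by (metis half_gt_zero)
    obtain D where D: "fine_list (min \<delta> \<delta>') s t D"
      using fine_list_exists[of "min \<delta> \<delta>'" s t] \<delta> \<delta>' st by auto
    have "norm (list_prod A D - Q) < e / 2" by (rule \<delta>') (rule fine_list_mono[OF D], simp)
    moreover have "norm (list_prod A D - list_prod A (if s = t then [s] else [s, t])) \<le> e / 2"
      using st by (intro \<delta>(2)[of s t] fine_list_mono[OF D] fine_list_short) auto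
    then have "norm (list_prod A D - (id_blinfun + A t - A s)) \<le> e / 2" by (simp split: if_splits)
    ultimately show "norm (Q - (id_blinfun + A t - A s)) < e"
      using dist_triangle[of Q "id_blinfun + A t - A s" "list_prod A D"]
      unfolding dist_norm norm_minus_commute[of Q "list_prod A D"] by linarith
  qed
qed

text \<open>Meant for \<open>R\<close> equal to the identity, I + \<Delta>^+ A(c) or I + \<Delta>^-
  A(c): openness of the invertible operators transfers invertibility from \<open>R\<close> to the
  limit.\<close>

lemma list_prod_limit_invertible_near:
  assumes "blinfun_invertible R"
  obtains \<delta> e where "\<delta> > 0" "e > 0"
    "\<And>s t Q. a \<le> s \<Longrightarrow> s \<le> t \<Longrightarrow> t \<le> b \<Longrightarrow> t - s < \<delta> \<Longrightarrow> list_prod_limit A s t Q \<Longrightarrow>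
       norm (id_blinfun + A t - A s - R) < e \<Longrightarrow> blinfun_invertible Q"
proof -
  obtain e where e: "e > 0" "\<And>R'. norm (R' - R) < e \<Longrightarrow> blinfun_invertible R'"
    using blinfun_invertible_open[OF assms] by blast
  obtain \<delta> where \<delta>: "\<delta> > 0"
    "\<And>s t Q. a \<le> s \<Longrightarrow> s \<le> t \<Longrightarrow> t \<le> b \<Longrightarrow> t - s < \<delta> \<Longrightarrow> list_prod_limit A s t Q \<Longrightarrow>
       norm (Q - (id_blinfun + A t - A s)) < e / 2"
    using list_prod_limit_near_increment[of "e / 2"] e(1) by (metis half_gt_zero)
  show ?thesis
  proof (rule that[OF \<delta>(1), of "e / 2"])
    fix s t Q
    assume "a \<le> s" "s \<le> t" "t \<le> b" "t - s < \<delta>" "list_prod_limit A s t Q"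
      and near: "norm (id_blinfun + A t - A s - R) < e / 2"
    then have "norm (Q - (id_blinfun + A t - A s)) < e / 2" using \<delta>(2)[of s t Q] by simp
    then have "norm (Q - R) < e"
      using near norm_triangle_ineq[of "Q - (id_blinfun + A t - A s)" "id_blinfun + A t - A s - R"] by simp
    then show "blinfun_invertible Q" by (rule e(2))
  qed (use e in simp)
qed

text \<open>As t decreases to c, I + A(t) - A(c) tends to I + \<Delta>^+ A(c), so short intervals
  starting at c have invertible limits; those ending at c are symmetric. Splitting at c and
  bisecting carry this to \<open>[a, b]\<close>.\<close>

lemma list_prod_limit_invertible:
  assumes "a \<le> b" and Q: "list_prod_limit A a b Q"
    and right: "\<And>c. a \<le> c \<Longrightarrow> c < b \<Longrightarrow> \<exists>L. (A \<longlongrightarrow> L) (at_right c) \<and> blinfun_invertible (id_blinfun + L - A c)"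
    and left: "\<And>c. a < c \<Longrightarrow> c \<le> b \<Longrightarrow> \<exists>L. (A \<longlongrightarrow> L) (at_left c) \<and> blinfun_invertible (id_blinfun + A c - L)"
  shows "blinfun_invertible Q"
proof -
  have "blinfun_invertible (id_blinfun :: 'x \<Rightarrow>\<^sub>L 'x)"
    unfolding blinfun_invertible_def by (rule exI[of _ id_blinfun]) simp
  then obtain \<delta>0 e0 where \<delta>0: "\<delta>0 > 0" "e0 > 0"
    "\<And>s t Q. a \<le> s \<Longrightarrow> s \<le> t \<Longrightarrow> t \<le> b \<Longrightarrow> t - s < \<delta>0 \<Longrightarrow> list_prod_limit A s t Q \<Longrightarrow>
       norm (id_blinfun + A t - A s - id_blinfun) < e0 \<Longrightarrow> blinfun_invertible Q"
    by (rule list_prod_limit_invertible_near) blast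
  \<comment> \<open>One-point intervals are treated apart, because one-sided limits at
    \<open>c\<close> say nothing about the point \<open>c\<close> itself.\<close>
  have trivial: "blinfun_invertible Q" if "a \<le> c" "c \<le> b" "list_prod_limit A c c Q" for c Q
    using \<delta>0 that by (intro \<delta>0(3)[of c c Q]) auto
  have right': "\<exists>d>0. \<forall>t Q. c \<le> t \<and> t \<le> b \<and> t < c + d \<and> list_prod_limit A c t Q \<longrightarrow> blinfun_invertible Q"
    if c: "a \<le> c" "c \<le> b" for c
  proof (cases "c < b")
    case True
    then obtain L where L: "(A \<longlongrightarrow> L) (at_right c)" "blinfun_invertible (id_blinfun + L - A c)"
      using right c by blast
    obtain \<delta> e where \<delta>: "\<delta> > 0" "e > 0"
      "\<And>s t Q. a \<le> s \<Longrightarrow> s \<le> t \<Longrightarrow> t \<le> b \<Longrightarrow> t - s < \<delta> \<Longrightarrow> list_prod_limit A s t Q \<Longrightarrow>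
         norm (id_blinfun + A t - A s - (id_blinfun + L - A c)) < e \<Longrightarrow> blinfun_invertible Q"
      using list_prod_limit_invertible_near[OF L(2)] by metis
    have "eventually (\<lambda>t. dist (A t) L < e) (at_right c)" using L(1) \<delta>(2) by (intro tendstoD) auto
    then obtain d where d: "d > c" "\<And>t. c < t \<Longrightarrow> t < d \<Longrightarrow> dist (A t) L < e"
      by (auto simp: eventually_at_right_field)
    have "blinfun_invertible Q"
      if t: "c \<le> t" "t \<le> b" "t < c + min \<delta> (d - c)" "list_prod_limit A c t Q" for t Q
    proof (cases "t = c")
      case True
      then show ?thesis using trivial c t by blast
    next
      case False
      then show ?thesis using d(2)[of t] t c by (intro \<delta>(3)[of c t Q]) (auto simp: dist_norm)
    qed
    then show ?thesis using \<delta>(1) d(1) by (intro exI[of _ "min \<delta> (d - c)"]) auto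
  next
    case False
    then show ?thesis using trivial c by (intro exI[of _ 1]) (auto dest: order_antisym)
  qed
  have left': "\<exists>d>0. \<forall>s Q. a \<le> s \<and> s \<le> c \<and> c - d < s \<and> list_prod_limit A s c Q \<longrightarrow> blinfun_invertible Q"
    if c: "a \<le> c" "c \<le> b" for c
  proof (cases "a < c")
    case True
    then obtain L where L: "(A \<longlongrightarrow> L) (at_left c)" "blinfun_invertible (id_blinfun + A c - L)"
      using left c by blast
    obtain \<delta> e where \<delta>: "\<delta> > 0" "e > 0"
      "\<And>s t Q. a \<le> s \<Longrightarrow> s \<le> t \<Longrightarrow> t \<le> b \<Longrightarrow> t - s < \<delta> \<Longrightarrow> list_prod_limit A s t Q \<Longrightarrow>
         norm (id_blinfun + A t - A s - (id_blinfun + A c - L)) < e \<Longrightarrow> blinfun_invertible Q"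
      using list_prod_limit_invertible_near[OF L(2)] by metis
    have "eventually (\<lambda>t. dist (A t) L < e) (at_left c)" using L(1) \<delta>(2) by (intro tendstoD) auto
    then obtain d where d: "d < c" "\<And>t. d < t \<Longrightarrow> t < c \<Longrightarrow> dist (A t) L < e"
      by (auto simp: eventually_at_left_field)
    have "blinfun_invertible Q"
      if s: "a \<le> s" "s \<le> c" "c - min \<delta> (c - d) < s" "list_prod_limit A s c Q" for s Q
    proof (cases "s = c")
      case True
      then show ?thesis using trivial c s by blast
    next
      case False
      then show ?thesis using d(2)[of s] s c
        by (intro \<delta>(3)[of s c Q]) (auto simp: dist_norm norm_minus_commute)
    qed
    then show ?thesis using \<delta>(1) d(1) by (intro exI[of _ "min \<delta> (c - d)"]) auto
  next
    case False
    then show ?thesis using trivial c by (intro exI[of _ 1]) (auto dest: order_antisym)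
  qed
  \<comment> \<open>The bounds on \<open>s\<close> and \<open>t\<close> are part of the predicate
    because the small intervals tested by bisection may stick out of \<open>[a, b]\<close>.\<close>
  let ?P = "\<lambda>s t. \<forall>Q. list_prod_limit A s t Q \<and> a \<le> s \<and> s \<le> t \<and> t \<le> b \<longrightarrow> blinfun_invertible Q"
  have "?P a b"
    using assms(1)
  proof (induction rule: Bolzano[where P = ?P])
    case (trans s u t)
    show ?case
    proof (intro allI impI)
      fix Q assume Q: "list_prod_limit A s t Q \<and> a \<le> s \<and> s \<le> t \<and> t \<le> b"
      obtain Q1 where Q1: "list_prod_limit A s u Q1" using list_prod_limit_exists[of s u] Q trans by auto
      obtain Q2 where Q2: "list_prod_limit A u t Q2" using list_prod_limit_exists[of u t] Q trans by auto
      have "blinfun_invertible Q1" "blinfun_invertible Q2" using Q Q1 Q2 trans by auto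
      moreover have "Q = Q2 o\<^sub>L Q1" using Q Q1 Q2 trans by (intro list_prod_limit_join[of s u t]) auto
      ultimately show "blinfun_invertible Q" by (simp add: blinfun_invertible_compose)
    qed
  next
    case (local c)
    obtain d where d: "d > 0"
      "\<And>t Q. c \<le> t \<Longrightarrow> t \<le> b \<Longrightarrow> t < c + d \<Longrightarrow> list_prod_limit A c t Q \<Longrightarrow> blinfun_invertible Q"
      using right' local by metis
    obtain d' where d': "d' > 0"
      "\<And>s Q. a \<le> s \<Longrightarrow> s \<le> c \<Longrightarrow> c - d' < s \<Longrightarrow> list_prod_limit A s c Q \<Longrightarrow> blinfun_invertible Q"
      using left' local by metis
    have "blinfun_invertible Q"
      if st: "s \<le> c" "c \<le> t" "t - s < min d d'" "list_prod_limit A s t Q" "a \<le> s" "t \<le> b" for s t Q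
    proof -
      obtain Q1 where Q1: "list_prod_limit A s c Q1" using list_prod_limit_exists[of s c] st by auto
      obtain Q2 where Q2: "list_prod_limit A c t Q2" using list_prod_limit_exists[of c t] st by auto
      have "blinfun_invertible Q1" "blinfun_invertible Q2"
        using st Q1 Q2 by (auto intro: d(2)[of t] d'(2)[of s])
      moreover have "Q = Q2 o\<^sub>L Q1" using st Q1 Q2 by (intro list_prod_limit_join[of s c t]) auto
      ultimately show ?thesis by (simp add: blinfun_invertible_compose)
    qed
    then show ?case using d(1) d'(1) by (intro exI[of _ "min d d'"]) auto
  qed
  then show ?thesis using Q assms(1) by blast
qed

end

subsection \<open>Paths of finite variation\<close>

lemma tendsto_of_Cauchy_at_right:
  fixes f :: "real \<Rightarrow> 'v::banach"
  assumes "\<And>e. e > 0 \<Longrightarrow> \<exists>d>c. \<forall>x y. c < x \<and> x \<le> y \<and> y < d \<longrightarrow> norm (f y - f x) < e"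
  shows "\<exists>L. (f \<longlongrightarrow> L) (at_right c)"
proof -
  have "cauchy_filter (filtermap f (at_right c))"
    unfolding cauchy_filter_metric_filtermap
  proof (intro allI impI)
    fix e :: real assume "e > 0"
    then obtain d where d: "d > c" "\<And>x y. c < x \<Longrightarrow> x \<le> y \<Longrightarrow> y < d \<Longrightarrow> norm (f y - f x) < e"
      using assms by metis
    have "eventually (\<lambda>x. c < x \<and> x < d) (at_right c)"
      unfolding eventually_at_right_field using d(1) by blast
    moreover have "dist (f x) (f y) < e" if "c < x \<and> x < d" "c < y \<and> y < d" for x y
      using d(2)[of x y] d(2)[of y x] that by (cases "x \<le> y") (auto simp: dist_norm norm_minus_commute)
    ultimately show "\<exists>P. eventually P (at_right c) \<and> (\<forall>x y. P x \<and> P y \<longrightarrow> dist (f x) (f y) < e)"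
      by (intro exI[of _ "\<lambda>x. c < x \<and> x < d"]) blast
  qed
  moreover have "complete (UNIV :: 'v set)"
    by (meson Cauchy_convergent UNIV_I complete_def convergent_def)
  ultimately show ?thesis
    using complete_uniform[where S = "UNIV :: 'v set"] by (force simp: filterlim_def)
qed

text \<open>The monotone \<open>F\<close> approaches its infimum over \<open>{c<..b}\<close> at
  \<open>c\<close>, so its increments just to the right of \<open>c\<close> are small, and they
  dominate those of \<open>A\<close>.\<close>

lemma right_limit_of_control:
  fixes A :: "real \<Rightarrow> 'v::banach"
  assumes control: "\<And>s t. a \<le> s \<Longrightarrow> s \<le> t \<Longrightarrow> t \<le> b \<Longrightarrow> norm (A t - A s) powr p \<le> F t - F s"
    and "0 < p" and c: "a \<le> c" "c < b"
  shows "\<exists>L. (A \<longlongrightarrow> L) (at_right c)"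
proof (rule tendsto_of_Cauchy_at_right)
  fix e :: real assume "e > 0"
  have mono: "F s \<le> F t" if "a \<le> s" "s \<le> t" "t \<le> b" for s t
    using control[OF that] by (smt (verit) powr_ge_zero)
  define I where "I = Inf (F ` {c<..b})"
  have bdd: "bdd_below (F ` {c<..b})" using mono c by (intro bdd_belowI[of _ "F c"]) auto
  have "\<exists>x\<in>F ` {c<..b}. x < I + e powr p"
    unfolding I_def using c \<open>e > 0\<close> by (intro cInf_lessD) auto
  then obtain d where d: "c < d" "d \<le> b" "F d < I + e powr p" by auto
  have "norm (A y - A x) < e" if xy: "c < x" "x \<le> y" "y < d" for x y
  proof -
    have "I \<le> F x" unfolding I_def using bdd xy d by (intro cInf_lower) auto
    moreover have "F y \<le> F d" using mono xy c d by auto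
    moreover have "norm (A y - A x) powr p \<le> F y - F x" using control xy c d by auto
    ultimately have "norm (A y - A x) powr p < e powr p" using d by linarith
    then show ?thesis using \<open>e > 0\<close> \<open>0 < p\<close> by (smt (verit) norm_ge_zero powr_mono2)
  qed
  then show "\<exists>d>c. \<forall>x y. c < x \<and> x \<le> y \<and> y < d \<longrightarrow> norm (A y - A x) < e" using d(1) by blast
qed

text \<open>Time reversal reduces this to right limits; the sign in \<open>- F (- x)\<close>
  restores monotonicity.\<close>

lemma left_limit_of_control:
  fixes A :: "real \<Rightarrow> 'v::banach"
  assumes control: "\<And>s t. a \<le> s \<Longrightarrow> s \<le> t \<Longrightarrow> t \<le> b \<Longrightarrow> norm (A t - A s) powr p \<le> F t - F s"
    and "0 < p" and c: "a < c" "c \<le> b"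
  shows "\<exists>L. (A \<longlongrightarrow> L) (at_left c)"
  unfolding filterlim_at_left_to_right
proof (rule right_limit_of_control[where a = "- b" and b = "- a" and F = "\<lambda>x. - F (- x)"])
  fix s t assume "- b \<le> s" "s \<le> t" "t \<le> - a"
  then show "norm (A (- t) - A (- s)) powr p \<le> - F (- t) - - F (- s)"
    using control[of "- t" "- s"] by (simp add: norm_minus_commute)
qed (use assms in auto)

text \<open>Near each c, the values of \<open>A\<close> strictly to one side of c are close to the
  one-sided limit there. A Lebesgue number for the resulting cover of \<open>[a, b]\<close> makes
  the estimate uniform.\<close>

lemma uniform_small_side:
  fixes A :: "real \<Rightarrow> 'v::real_normed_vector"
  assumes right: "\<And>c. a \<le> c \<Longrightarrow> c < b \<Longrightarrow> \<exists>L. (A \<longlongrightarrow> L) (at_right c)"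
    and left: "\<And>c. a < c \<Longrightarrow> c \<le> b \<Longrightarrow> \<exists>L. (A \<longlongrightarrow> L) (at_left c)"
    and cont: "\<And>c. a < c \<Longrightarrow> c < b \<Longrightarrow> (A \<longlongrightarrow> A c) (at_right c) \<or> (A \<longlongrightarrow> A c) (at_left c)"
    and "0 < \<eta>"
  shows "\<exists>\<delta>>0. \<forall>s u t. a \<le> s \<and> s \<le> u \<and> u \<le> t \<and> t \<le> b \<and> t - s < \<delta> \<longrightarrow>
        norm (A u - A s) \<le> \<eta> \<or> norm (A t - A u) \<le> \<eta>"
proof -
  \<comment> \<open>The implication remembers that the limit is \<open>A c\<close> where
    \<open>A\<close> is right-continuous. At \<open>c = b\<close> the choice \<open>A c\<close> is a
    default, as no points lie to the right.\<close>
  have R: "\<exists>d>0. \<exists>L. ((A \<longlongrightarrow> A c) (at_right c) \<longrightarrow> L = A c) \<and> (\<forall>x. c < x \<and> x < c + d \<and> x \<le> b \<longrightarrow> dist (A x) L < \<eta> / 2)"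
    if "a \<le> c" "c \<le> b" for c
  proof (cases "c < b")
    case True
    then obtain L where L: "(A \<longlongrightarrow> L) (at_right c)" using right \<open>a \<le> c\<close> by blast
    have "eventually (\<lambda>x. dist (A x) L < \<eta> / 2) (at_right c)" using L \<open>0 < \<eta>\<close> by (intro tendstoD) auto
    then obtain d where d: "d > c" "\<And>x. c < x \<Longrightarrow> x < d \<Longrightarrow> dist (A x) L < \<eta> / 2"
      by (auto simp: eventually_at_right_field)
    have "L = A c" if "(A \<longlongrightarrow> A c) (at_right c)" using tendsto_unique[OF _ L that] by simp
    then show ?thesis using d by (intro exI[of _ "d - c"] conjI exI[of _ L]) auto
  next
    case False
    then show ?thesis by (intro exI[of _ 1] conjI exI[of _ "A c"]) auto
  qed
  have L: "\<exists>d>0. \<exists>L. ((A \<longlongrightarrow> A c) (at_left c) \<longrightarrow> L = A c) \<and> (\<forall>x. c - d < x \<and> x < c \<and> a \<le> x \<longrightarrow> dist (A x) L < \<eta> / 2)"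
    if "a \<le> c" "c \<le> b" for c
  proof (cases "a < c")
    case True
    then obtain L where L: "(A \<longlongrightarrow> L) (at_left c)" using left \<open>c \<le> b\<close> by blast
    have "eventually (\<lambda>x. dist (A x) L < \<eta> / 2) (at_left c)" using L \<open>0 < \<eta>\<close> by (intro tendstoD) auto
    then obtain d where d: "d < c" "\<And>x. d < x \<Longrightarrow> x < c \<Longrightarrow> dist (A x) L < \<eta> / 2"
      by (auto simp: eventually_at_left_field)
    have "L = A c" if "(A \<longlongrightarrow> A c) (at_left c)" using tendsto_unique[OF _ L that] by simp
    then show ?thesis using d by (intro exI[of _ "c - d"] conjI exI[of _ L]) auto
  next
    case False
    then show ?thesis by (intro exI[of _ 1] conjI exI[of _ "A c"]) auto
  qed
  have local: "\<exists>d>0. \<forall>s u t. a \<le> s \<and> s \<le> u \<and> u \<le> t \<and> t \<le> b \<and> {s, u, t} \<subseteq> ball c d \<longrightarrow>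
        norm (A u - A s) \<le> \<eta> \<or> norm (A t - A u) \<le> \<eta>" if c: "a \<le> c" "c \<le> b" for c
  proof -
    obtain d1 L1 where 1: "d1 > 0" "(A \<longlongrightarrow> A c) (at_right c) \<Longrightarrow> L1 = A c"
      "\<And>x. c < x \<Longrightarrow> x < c + d1 \<Longrightarrow> x \<le> b \<Longrightarrow> dist (A x) L1 < \<eta> / 2" using R[OF c] by blast
    obtain d2 L2 where 2: "d2 > 0" "(A \<longlongrightarrow> A c) (at_left c) \<Longrightarrow> L2 = A c"
      "\<And>x. c - d2 < x \<Longrightarrow> x < c \<Longrightarrow> a \<le> x \<Longrightarrow> dist (A x) L2 < \<eta> / 2" using L[OF c] by blast
    have close: "norm (A x - A y) \<le> \<eta>" if "dist (A x) M < \<eta> / 2" "dist (A y) M < \<eta> / 2" for x y M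
      using dist_triangle_half_l[OF that] by (simp add: dist_norm)
    have "norm (A u - A s) \<le> \<eta> \<or> norm (A t - A u) \<le> \<eta>"
      if sut: "a \<le> s" "s \<le> u" "u \<le> t" "t \<le> b" and near: "{s, u, t} \<subseteq> ball c (min d1 d2)" for s u t
    proof -
      have near: "c - d2 < s" "t < c + d1" "c - d2 < u" "u < c + d1"
        using near by (auto simp: dist_real_def)
      \<comment> \<open>If \<open>u\<close> differs from \<open>c\<close>, then \<open>u\<close> and
        its neighbour farther from \<open>c\<close> lie on the same side. If \<open>u = c\<close> is
        strictly between, one-sided continuity identifies \<open>A c\<close> with one of the two
        limits. Otherwise one increment is zero.\<close>
      consider "u < c" | "u > c" | "u = c" "s = c" | "u = c" "t = c" | "u = c" "s < c" "c < t"
        using sut by linarith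
      then show ?thesis
      proof cases
        case 1
        then show ?thesis using sut near close[OF "2"(3)[of u] "2"(3)[of s]] by auto
      next
        case 2
        then show ?thesis using sut near close[OF "1"(3)[of t] "1"(3)[of u]] by auto
      next
        case 5
        then have "L1 = A c \<or> L2 = A c" using cont[of c] sut "1"(2) "2"(2) by auto
        then show ?thesis
        proof
          assume "L1 = A c"
          then have "dist (A c) L1 < \<eta> / 2" using \<open>0 < \<eta>\<close> by simp
          then show ?thesis using 5 sut near close[OF "1"(3)[of t], of c] by auto
        next
          assume "L2 = A c"
          then have "dist (A c) L2 < \<eta> / 2" using \<open>0 < \<eta>\<close> by simp
          then show ?thesis using 5 sut near close[OF _ "2"(3)[of s], of c] by auto
        qed
      qed (use \<open>0 < \<eta>\<close> in auto)
    qed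
    then show ?thesis using 1(1) 2(1) by (intro exI[of _ "min d1 d2"]) auto
  qed
  then obtain d where d: "\<And>c. c \<in> {a..b} \<Longrightarrow> d c > 0"
    "\<And>c s u t. c \<in> {a..b} \<Longrightarrow> a \<le> s \<Longrightarrow> s \<le> u \<Longrightarrow> u \<le> t \<Longrightarrow> t \<le> b \<Longrightarrow> {s, u, t} \<subseteq> ball c (d c) \<Longrightarrow>
        norm (A u - A s) \<le> \<eta> \<or> norm (A t - A u) \<le> \<eta>"
    unfolding atLeastAtMost_iff by metis
  obtain \<delta> where \<delta>: "0 < \<delta>" "\<And>x. x \<in> {a..b} \<Longrightarrow> \<exists>G \<in> (\<lambda>c. ball c (d c)) ` {a..b}. ball x \<delta> \<subseteq> G"
    by (rule Heine_Borel_lemma[of "{a..b}" "(\<lambda>c. ball c (d c)) ` {a..b}"]) (use d(1) in auto)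
  have "norm (A u - A s) \<le> \<eta> \<or> norm (A t - A u) \<le> \<eta>"
    if sut: "a \<le> s" "s \<le> u" "u \<le> t" "t \<le> b" "t - s < \<delta>" for s u t
  proof -
    obtain c where c: "c \<in> {a..b}" "ball s \<delta> \<subseteq> ball c (d c)" using \<delta>(2)[of s] sut by fastforce
    have "{s, u, t} \<subseteq> ball s \<delta>" using that by (auto simp: dist_real_def)
    then show ?thesis using d(2)[OF c(1), of s u t] c(2) that by blast
  qed
  then show ?thesis using \<delta>(1) by blast
qed

section \<open>Control function of a path of finite p-variation\<close>

lemma is_partition_extend:
  assumes "is_partition a s m u" "s < t"
  shows "is_partition a t (Suc m) (u(Suc m := t))"
  using assms unfolding is_partition_def by (auto simp: less_Suc_eq)

text \<open>\<open>F t\<close> is the supremum of the p-th power sums over partitions of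
  \<open>[a, t]\<close>. Appending \<open>t\<close> to a partition of \<open>[a, s]\<close> adds the
  power of the last increment, which is the required superadditivity.\<close>

lemma control_of_p_variation:
  fixes A :: "real \<Rightarrow> 'v::real_normed_vector"
  assumes "0 < p" "p_variation p a b A < \<infinity>"
  obtains F where "\<And>s t. a \<le> s \<Longrightarrow> s \<le> t \<Longrightarrow> t \<le> b \<Longrightarrow> norm (A t - A s) powr p \<le> F t - F s"
proof -
  let ?S = "\<lambda>m u. \<Sum>i<m. norm (A (u (Suc i)) - A (u i)) powr p"
  define V where "V t = {?S m u | m u. is_partition a t m u}" for t
  obtain v where v: "p_variation p a b A = ennreal v" "0 \<le> v"
    using assms(2) by (cases "p_variation p a b A") auto
  have bound: "x \<le> v powr p" if x: "x \<in> V b" for x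
  proof -
    obtain m u where u: "x = ?S m u" "is_partition a b m u" using x unfolding V_def by blast
    have "ennreal (x powr (1 / p)) \<le> p_variation p a b A"
      unfolding p_variation_def u(1) using u(2) by (intro SUP_upper2[of "(m, u)"]) auto
    then have "x powr (1 / p) \<le> v" using v by (simp add: ennreal_le_iff)
    then have "(x powr (1 / p)) powr p \<le> v powr p" using assms(1) by (intro powr_mono2) auto
    moreover have "x \<ge> 0" unfolding u by (intro sum_nonneg) auto
    ultimately show ?thesis using assms(1) by (simp add: powr_powr)
  qed
  have step: "x + norm (A t - A s) powr p \<in> V t" if x: "x \<in> V s" "s < t" for x s t
  proof -
    obtain m u where u: "x = ?S m u" "is_partition a s m u" using x unfolding V_def by blast
    have "x + norm (A t - A s) powr p = ?S (Suc m) (u(Suc m := t))"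
      using u by (simp add: is_partition_def)
    then show ?thesis using is_partition_extend[OF u(2) \<open>s < t\<close>] unfolding V_def by blast
  qed
  \<comment> \<open>The partition with \<open>m = 0\<close> has the single point \<open>a\<close>
    and an empty sum; extending it shows that every \<open>V t\<close> is nonempty.\<close>
  have "0 \<in> V a" unfolding V_def by (auto simp: is_partition_def intro!: exI[of _ 0] exI[of _ "\<lambda>_. a"])
  then have ne: "V t \<noteq> {}" if "a \<le> t" for t
    using step[of 0 a t] that by (cases "a = t") auto
  have bdd: "bdd_above (V t)" if "t \<le> b" for t
  proof (rule bdd_aboveI)
    fix x assume x: "x \<in> V t"
    show "x \<le> v powr p"
    proof (cases "t = b")
      case False
      \<comment> \<open>A partition of \<open>[a, t]\<close> is completed by the point
        \<open>b\<close>, which only increases the sum.\<close>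
      then have "x + norm (A b - A t) powr p \<le> v powr p" using step[OF x, of b] bound that by auto
      then show ?thesis by (smt (verit) powr_ge_zero)
    qed (use bound x in auto)
  qed
  show ?thesis
  proof (rule that[of "\<lambda>t. Sup (V t)"])
    fix s t assume st: "a \<le> s" "s \<le> t" "t \<le> b"
    show "norm (A t - A s) powr p \<le> Sup (V t) - Sup (V s)"
    proof (cases "s = t")
      case False
      have "Sup (V s) \<le> Sup (V t) - norm (A t - A s) powr p"
      proof (rule cSup_least[OF ne[OF st(1)]])
        fix x assume "x \<in> V s"
        then have "x + norm (A t - A s) powr p \<le> Sup (V t)"
          using step[of x s t] False st by (intro cSup_upper bdd) auto
        then show "x \<le> Sup (V t) - norm (A t - A s) powr p" by simp
      qed
      then show ?thesis by simp
    qed (use assms in simp)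
  qed
qed

subsection \<open>Product integrals\<close>

lemma map_upt_Suc_Suc: "map t [0..<Suc (Suc m)] = map t [0..<m] @ [t m, t (Suc m)]"
  by simp

lemma successively_map_upt:
  "(\<And>i. i < m \<Longrightarrow> P (t i) (t (Suc i))) \<Longrightarrow> successively P (map t [0..<Suc m])"
proof (induction m)
  case (Suc m)
  then have "successively P (map t [0..<m] @ [t m])" by simp
  then show ?case unfolding map_upt_Suc_Suc using Suc.prems[of m]
    by (simp add: successively_append_iff)
qed simp

lemma list_prod_map_upt:
  "list_prod A (map t [0..<Suc m]) = ordered_prod (\<lambda>i. id_blinfun + A (t (Suc i)) - A (t i)) m"
proof (induction m)
  case (Suc m)
  have "list_prod A (map t [0..<m] @ t m # [t (Suc m)])
      = list_prod A [t m, t (Suc m)] o\<^sub>L list_prod A (map t [0..<m] @ [t m])"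
    by (rule list_prod_append)
  then show ?case using Suc unfolding map_upt_Suc_Suc by simp
qed simp

text \<open>Both endpoints lie within \<open>\<delta> / 2\<close> of the tag, hence within
  \<open>\<delta>\<close> of each other.\<close>

lemma fine_list_of_partition:
  assumes "is_tagged_partition a b m t \<xi>" "delta_fine (\<delta> / 2) m t \<xi>"
  shows "fine_list \<delta> a b (map t [0..<Suc m])"
proof -
  have t: "t 0 = a" "t m = b" "\<And>i. i < m \<Longrightarrow> t i < t (Suc i)"
    using assms(1) by (auto simp: is_tagged_partition_def is_partition_def)
  have "t (Suc i) - t i < \<delta>" if "i < m" for i
  proof -
    have "t i \<in> {t i..t (Suc i)}" "t (Suc i) \<in> {t i..t (Suc i)}" using t(3)[OF that] by auto
    then have "t i \<in> {\<xi> i - \<delta> / 2<..<\<xi> i + \<delta> / 2}" "t (Suc i) \<in> {\<xi> i - \<delta> / 2<..<\<xi> i + \<delta> / 2}"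
      using assms(2) that unfolding delta_fine_def by blast+
    then show ?thesis by auto
  qed
  then have "successively (\<lambda>x y. y - x < \<delta>) (map t [0..<Suc m])" by (intro successively_map_upt)
  moreover have "successively (<) (map t [0..<Suc m])" using t(3) by (intro successively_map_upt)
  then have "sorted_wrt (<) (map t [0..<Suc m])" by (subst (asm) successively_conv_sorted_wrt) auto
  moreover have "hd (map t [0..<Suc m]) = a" using t(1) by (simp del: upt_Suc add: hd_map)
  moreover have "last (map t [0..<Suc m]) = b" using t(2) by simp
  ultimately show ?thesis by (simp add: fine_list_def del: upt_Suc)
qed

text \<open>Without such partitions both limit conditions would be vacuous, so uniqueness of the two
  products rests on this. Equal steps tagged at their left ends suffice.\<close>

lemma fine_tagged_partition_exists:
  fixes a b \<delta> :: real
  assumes "a < b" "0 < \<delta>"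
  shows "\<exists>m t \<xi>. is_tagged_partition a b m t \<xi> \<and> delta_fine \<delta> m t \<xi>"
proof -
  obtain m :: nat where m: "(b - a) / \<delta> < m" using reals_Archimedean2 by blast
  have "0 < (b - a) / \<delta>" using assms by simp
  then have "m > 0" using m by (cases m) auto
  define h where "h = (b - a) / m"
  have h: "0 < h" "h < \<delta>" "m * h = b - a"
    using m assms \<open>m > 0\<close> by (auto simp: h_def field_simps)
  define t where "t i = a + real i * h" for i
  have "t m = b" using h by (simp add: t_def)
  moreover have "t (Suc i) = t i + h" for i by (simp add: t_def algebra_simps)
  ultimately have "is_tagged_partition a b m t t" "delta_fine \<delta> m t t"
    using h by (auto simp: is_tagged_partition_def is_partition_def delta_fine_def t_def)
  then show ?thesis by blast
qed

section \<open>Uniqueness of both products\<close>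

lemma has_RS_product_integral_unique:
  assumes "a < b" "has_RS_product_integral A Q a b" "has_RS_product_integral A Q' a b"
  shows "Q = Q'"
proof (rule ccontr)
  assume "Q \<noteq> Q'"
  define e where "e = norm (Q - Q') / 2"
  have e: "e > 0" using \<open>Q \<noteq> Q'\<close> by (simp add: e_def)
  let ?R = "\<lambda>m t. ordered_prod (\<lambda>i. id_blinfun + A (t (Suc i)) - A (t i)) m"
  obtain d where d: "d > 0" "\<And>m t \<xi>. is_tagged_partition a b m t \<xi> \<Longrightarrow> delta_fine d m t \<xi> \<Longrightarrow> norm (?R m t - Q) < e"
    using assms(2) e unfolding has_RS_product_integral_def by blast
  obtain d' where d': "d' > 0" "\<And>m t \<xi>. is_tagged_partition a b m t \<xi> \<Longrightarrow> delta_fine d' m t \<xi> \<Longrightarrow> norm (?R m t - Q') < e"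
    using assms(3) e unfolding has_RS_product_integral_def by blast
  obtain m t \<xi> where p: "is_tagged_partition a b m t \<xi>" "delta_fine (min d d') m t \<xi>"
    using fine_tagged_partition_exists[of a b "min d d'"] assms(1) d(1) d'(1) by auto
  then have "delta_fine d m t \<xi>" "delta_fine d' m t \<xi>" by (fastforce simp: delta_fine_def)+
  then have "norm (?R m t - Q) < e" "norm (?R m t - Q') < e" using d(2) d'(2) p(1) by blast+
  then have "norm (Q - Q') < e + e"
    using norm_triangle_ineq4[of "?R m t - Q'" "?R m t - Q"] by simp
  then show False by (simp add: e_def)
qed

lemma has_Haahti_product_unique:
  assumes "a < b" "has_Haahti_product A Q a b" "has_Haahti_product A Q' a b"
  shows "Q = Q'"
proof (rule ccontr)
  assume "Q \<noteq> Q'"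
  define e where "e = norm (Q - Q') / 2"
  have e: "e > 0" using \<open>Q \<noteq> Q'\<close> by (simp add: e_def)
  let ?R = "\<lambda>m t. ordered_prod (\<lambda>i. A (t i)) (Suc m)"
  obtain d where d: "d > 0" "\<And>m t \<xi>. is_tagged_partition a b m t \<xi> \<Longrightarrow> delta_fine d m t \<xi> \<Longrightarrow> norm (Q - ?R m t) < e"
    using assms(2) e unfolding has_Haahti_product_def by blast
  obtain d' where d': "d' > 0" "\<And>m t \<xi>. is_tagged_partition a b m t \<xi> \<Longrightarrow> delta_fine d' m t \<xi> \<Longrightarrow> norm (Q' - ?R m t) < e"
    using assms(3) e unfolding has_Haahti_product_def by blast
  obtain m t \<xi> where p: "is_tagged_partition a b m t \<xi>" "delta_fine (min d d') m t \<xi>"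
    using fine_tagged_partition_exists[of a b "min d d'"] assms(1) d(1) d'(1) by auto
  then have "delta_fine d m t \<xi>" "delta_fine d' m t \<xi>" by (fastforce simp: delta_fine_def)+
  then have "norm (Q - ?R m t) < e" "norm (Q' - ?R m t) < e" using d(2) d'(2) p(1) by blast+
  then have "norm (Q - Q') < e + e"
    using norm_triangle_ineq4[of "Q - ?R m t" "Q' - ?R m t"] by simp
  then show False by (simp add: e_def)
qed

lemma RS_product_integral_eq:
  "a < b \<Longrightarrow> has_RS_product_integral A Q a b \<Longrightarrow> RS_product_integral A a b = Q"
  unfolding RS_product_integral_def by (rule the_equality) (auto intro: has_RS_product_integral_unique)

lemma Haahti_product_eq:
  "a < b \<Longrightarrow> has_Haahti_product A Q a b \<Longrightarrow> Haahti_product A a b = Q"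
  unfolding Haahti_product_def by (rule the_equality) (auto intro: has_Haahti_product_unique)

lemma has_RS_product_integral_of_limit:
  assumes "blinfun_invertible Q" "list_prod_limit A a b Q"
  shows "has_RS_product_integral A Q a b"
  unfolding has_RS_product_integral_def
proof (intro conjI allI impI)
  fix e :: real assume "e > 0"
  then obtain \<delta> where "\<delta> > 0" "\<And>D. fine_list \<delta> a b D \<Longrightarrow> norm (list_prod A D - Q) < e"
    using assms(2) unfolding list_prod_limit_def by blast
  then show "\<exists>\<delta>>0. \<forall>m t \<xi>. is_tagged_partition a b m t \<xi> \<longrightarrow> delta_fine \<delta> m t \<xi> \<longrightarrow>
      norm (ordered_prod (\<lambda>i. id_blinfun + A (t (Suc i)) - A (t i)) m - Q) < e"
    using fine_list_of_partition
    by (intro exI[of _ "\<delta> / 2"]) (auto simp flip: list_prod_map_upt simp del: upt_Suc)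
qed (fact assms(1))

text \<open>Idempotence cancels P(m) against P(m)P(m) in (I + P(m+1) - P(m))P(m), leaving
  P(m+1)P(m). There are \<open>m + 1\<close> factors but only \<open>m\<close> increments; the
  surplus factor is \<open>P 0\<close>.\<close>

lemma ordered_prod_projections:
  assumes "\<And>i. P i o\<^sub>L P i = P i"
  shows "ordered_prod P (Suc m) = ordered_prod (\<lambda>i. id_blinfun + P (Suc i) - P i) m o\<^sub>L P 0"
proof (induction m)
  case (Suc m)
  let ?R = "ordered_prod P m"
  have "(id_blinfun + P (Suc m) - P m) o\<^sub>L (P m o\<^sub>L ?R)
      = (P m o\<^sub>L ?R) + (P (Suc m) o\<^sub>L (P m o\<^sub>L ?R)) - ((P m o\<^sub>L P m) o\<^sub>L ?R)"
    by (rule blinfun_eqI) (simp add: blinfun.bilinear_simps)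
  then have step: "ordered_prod P (Suc (Suc m)) = (id_blinfun + P (Suc m) - P m) o\<^sub>L ordered_prod P (Suc m)"
    by (simp add: assms)
  show ?case unfolding step Suc.IH by (simp add: blinfun_compose_assoc)
qed simp

lemma has_Haahti_product_of_projections:
  assumes proj: "\<And>t. A t o\<^sub>L A t = A t" and Q: "has_RS_product_integral A Q a b"
  shows "has_Haahti_product A (Q o\<^sub>L A a) a b"
  unfolding has_Haahti_product_def
proof (intro allI impI)
  fix e :: real assume "e > 0"
  \<comment> \<open>Multiplying by \<open>A a\<close> on the right enlarges errors by at most
    \<open>norm (A a)\<close>; the 1 keeps the denominator positive.\<close>
  then have "e / (norm (A a) + 1) > 0" by (simp add: add_nonneg_pos)
  then obtain \<delta> where \<delta>: "\<delta> > 0" "\<And>m t \<xi>. is_tagged_partition a b m t \<xi> \<Longrightarrow> delta_fine \<delta> m t \<xi> \<Longrightarrow>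
      norm (ordered_prod (\<lambda>i. id_blinfun + A (t (Suc i)) - A (t i)) m - Q) < e / (norm (A a) + 1)"
    using Q unfolding has_RS_product_integral_def by blast
  have "norm ((Q o\<^sub>L A a) - ordered_prod (\<lambda>i. A (t i)) (Suc m)) < e"
    if "is_tagged_partition a b m t \<xi>" "delta_fine \<delta> m t \<xi>" for m t \<xi>
  proof -
    let ?R = "ordered_prod (\<lambda>i. id_blinfun + A (t (Suc i)) - A (t i)) m"
    have "t 0 = a" using that(1) by (simp add: is_tagged_partition_def is_partition_def)
    then have "ordered_prod (\<lambda>i. A (t i)) (Suc m) = ?R o\<^sub>L A a"
      using ordered_prod_projections[of "\<lambda>i. A (t i)" m] proj by simp
    then have "(Q o\<^sub>L A a) - ordered_prod (\<lambda>i. A (t i)) (Suc m) = (Q - ?R) o\<^sub>L A a"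
      by (intro blinfun_eqI) (simp add: blinfun.bilinear_simps)
    then have "norm ((Q o\<^sub>L A a) - ordered_prod (\<lambda>i. A (t i)) (Suc m)) \<le> norm (?R - Q) * norm (A a)"
      using norm_blinfun_compose[of "Q - ?R" "A a"] by (simp add: norm_minus_commute)
    also have "\<dots> \<le> norm (?R - Q) * (norm (A a) + 1)" by (intro mult_left_mono) auto
    also have "\<dots> < e" using \<delta>(2)[OF that] by (simp add: less_divide_eq add_nonneg_pos)
    finally show ?thesis .
  qed
  then show "\<exists>\<delta>>0. \<forall>m t \<xi>. is_tagged_partition a b m t \<xi> \<longrightarrow> delta_fine \<delta> m t \<xi> \<longrightarrow>
      norm ((Q o\<^sub>L A a) - ordered_prod (\<lambda>i. A (t i)) (Suc m)) < e" using \<delta>(1) by blast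
qed

theorem theorem7p5:
  fixes P :: "'m::t2_space \<Rightarrow> ('x::banach \<Rightarrow>\<^sub>L 'x)"
    and l :: "real \<Rightarrow> 'm"
    and a b p :: real
  assumes "a < b"
    and "projection_valued P"
    and "continuous_on {a..b} l"
    and "\<And>t. t \<in> {a<..<b} \<Longrightarrow>
           continuous (at_right t) (P \<circ> l) \<or> continuous (at_left t) (P \<circ> l)"
    and "0 < p" and "p < 2"
    and "p_variation p a b (P \<circ> l) < \<infinity>"
    and "\<And>t. t \<in> {a..<b} \<Longrightarrow> blinfun_invertible (id_blinfun + right_jump (P \<circ> l) t)"
    and "\<And>t. t \<in> {a<..b} \<Longrightarrow> blinfun_invertible (id_blinfun + left_jump (P \<circ> l) t)"
  shows "RS_product_integrable (P \<circ> l) a b \<and>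
         Haahti_product_exists (P \<circ> l) a b \<and>
         Haahti_product (P \<circ> l) a b = RS_product_integral (P \<circ> l) a b o\<^sub>L P (l a)"
proof -
  define A where "A = P \<circ> l"
  obtain F where control: "\<And>s t. a \<le> s \<Longrightarrow> s \<le> t \<Longrightarrow> t \<le> b \<Longrightarrow> norm (A t - A s) powr p \<le> F t - F s"
    using control_of_p_variation[OF assms(5,7)] unfolding A_def by blast
  have right: "\<exists>L. (A \<longlongrightarrow> L) (at_right c)" if "a \<le> c" "c < b" for c
    using right_limit_of_control[of a b A p F c, OF control \<open>0 < p\<close> that] by blast
  have left: "\<exists>L. (A \<longlongrightarrow> L) (at_left c)" if "a < c" "c \<le> b" for c
    using left_limit_of_control[of a b A p F c, OF control \<open>0 < p\<close> that] by blast
  have cont: "(A \<longlongrightarrow> A c) (at_right c) \<or> (A \<longlongrightarrow> A c) (at_left c)" if "a < c" "c < b" for c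
    using assms(4)[of c] that unfolding A_def[symmetric] continuous_within by simp
  interpret controlled_path A F a b p
    by unfold_locales
      (use assms(5,6) control uniform_small_side[OF right left cont] in auto)
  obtain Q where Q: "list_prod_limit A a b Q"
    using list_prod_limit_exists[of a b] assms(1) by auto
  have "blinfun_invertible Q"
  proof (rule list_prod_limit_invertible[OF _ Q])
    fix c assume c: "a \<le> c" "c < b"
    then obtain L where L: "(A \<longlongrightarrow> L) (at_right c)" using right by blast
    \<comment> \<open>\<open>Lim\<close> is a description operator, so the jump is
      \<open>L - A c\<close> only once convergence is known.\<close>
    then have "Lim (at_right c) A = L" by (intro tendsto_Lim) auto
    then show "\<exists>L. (A \<longlongrightarrow> L) (at_right c) \<and> blinfun_invertible (id_blinfun + L - A c)"
      using L assms(8)[of c] c unfolding A_def[symmetric] right_jump_def by (auto simp: add_diff_eq)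
  next
    fix c assume c: "a < c" "c \<le> b"
    then obtain L where L: "(A \<longlongrightarrow> L) (at_left c)" using left by blast
    then have "Lim (at_left c) A = L" by (intro tendsto_Lim) auto
    then show "\<exists>L. (A \<longlongrightarrow> L) (at_left c) \<and> blinfun_invertible (id_blinfun + A c - L)"
      using L assms(9)[of c] c unfolding A_def[symmetric] left_jump_def by (auto simp: add_diff_eq)
  qed (use assms(1) in simp)
  then have RS: "has_RS_product_integral A Q a b" using Q by (rule has_RS_product_integral_of_limit)
  have "has_Haahti_product A (Q o\<^sub>L A a) a b"
    using assms(2) by (intro has_Haahti_product_of_projections RS) (simp add: A_def projection_valued_def)
  then show ?thesis
    using RS RS_product_integral_eq[OF assms(1) RS] Haahti_product_eq[OF assms(1)]
    unfolding A_def[symmetric] RS_product_integrable_def Haahti_product_exists_def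
    by (auto simp: A_def)
qed

end
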